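(* Let $X$ be a real non-normal random variable with $\mathbb{E}X=0$, $\mathrm{Var}(X)=1$ and $\mathbb{E}\,e^{b|X|}<\infty$ for some $b>0$, let $(X_k)_{k\ge 1}$ be independent copies of $X$, and let $Z_n=(X_1+\dots+X_n)/\sqrt n$. Assume that for some $n_0\ge1$ the random variable $Z_{n_0}$ has a bounded density, and for $n\ge 2n_0$ let $p_n$ be the continuous bounded density of $Z_n$. Let $\gamma_m$ ($m\ge3$) be the first non-zero cumulant of $X$ of order at least $3$, and suppose that $m$ is even, $m\ge4$, and $\gamma_m<0$. Then there exist constants $\tau_0>0$ and $c>0$ such that, for all $n\ge 2n_0$ and all real $x$ such that $\tau=x/\sqrt n$ satisfies $|\tau|\le\tau_0$, $$\frac{p_n(x)-\varphi(x)}{\varphi(x)}\le\frac{c(\log n)^3}{n}.$$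
   Context: $\varphi(x)=\frac{1}{\sqrt{2\pi}}e^{-x^2/2}$. Under the stated assumptions, every $Z_n$ with $n\ge 2n_0$ has a continuous bounded density. The cumulants of $X$ are $\gamma_k=K^{(k)}(0)$, where $K(z)=\log\mathbb{E}\,e^{zX}$ near $z=0$; here $\gamma_1=0$, $\gamma_2=1$. The index $m$ is the smallest integer $k\ge3$ with $\gamma_k\neq0$; equivalently the smallest positive integer with $\mathbb{E}X^m\ne\mathbb{E}Z^m$, $Z$ standard normal, and then $\gamma_m=\mathbb{E}X^m-\mathbb{E}Z^m$. The constants $\tau_0,c$ may depend on the distribution of $X$ and on $n_0$, but not on $n$ and $x$. *)

theory Defs
  imports "HOL-Probability.Probability"
begin

definition has_bounded_density :: "'a measure \<Rightarrow> ('a \<Rightarrow> real) \<Rightarrow> bool" where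
  "has_bounded_density M Y \<longleftrightarrow>
     (\<exists>f :: real \<Rightarrow> real. distributed M lborel Y f \<and> (\<forall>x. 0 \<le> f x) \<and> bounded (range f))"

text \<open>
  Among everywhere nonnegative functions, a continuous Lebesgue density is unique.  Nonnegativity
  has to be stated, because the coercion to \<^typ>\<open>ennreal\<close> inside \<^const>\<open>distributed\<close> truncates
  negative values.
\<close>

definition continuous_bounded_density :: "'a measure \<Rightarrow> ('a \<Rightarrow> real) \<Rightarrow> real \<Rightarrow> real" where
  "continuous_bounded_density M Y =
     (THE p :: real \<Rightarrow> real. distributed M lborel Y p \<and> (\<forall>x. 0 \<le> p x) \<and>
        continuous_on UNIV p \<and> bounded (range p))"

definition normally_distributed :: "'a measure \<Rightarrow> ('a \<Rightarrow> real) \<Rightarrow> bool" where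
  "normally_distributed M X \<longleftrightarrow>
     (\<exists>\<mu> \<sigma> :: real. 0 < \<sigma> \<and> distributed M lborel X (normal_density \<mu> \<sigma>))"

text \<open>
  Iterated derivatives at 0 depend only on the values near 0, so it is harmless that the integral
  is 0 by convention for those \<open>z\<close> at which the exponential moment is infinite.
\<close>

definition cumulant_gen :: "'a measure \<Rightarrow> ('a \<Rightarrow> real) \<Rightarrow> real \<Rightarrow> real" where
  "cumulant_gen M X z = ln (\<integral>\<omega>. exp (z * X \<omega>) \<partial>M)"

definition cumulant :: "'a measure \<Rightarrow> ('a \<Rightarrow> real) \<Rightarrow> nat \<Rightarrow> real" where
  "cumulant M X k = (deriv ^^ k) (cumulant_gen M X) 0"

definition independent_copies :: "'a measure \<Rightarrow> ('a \<Rightarrow> real) \<Rightarrow> (nat \<Rightarrow> 'a \<Rightarrow> real) \<Rightarrow> bool" where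
  "independent_copies M X Xs \<longleftrightarrow>
     prob_space.indep_vars M (\<lambda>_. borel) Xs {1..} \<and>
     (\<forall>k\<ge>1. distr M borel (Xs k) = distr M borel X)"

definition normalized_sum :: "(nat \<Rightarrow> 'a \<Rightarrow> real) \<Rightarrow> nat \<Rightarrow> 'a \<Rightarrow> real" where
  "normalized_sum Xs n \<omega> = (\<Sum>k=1..n. Xs k \<omega>) / sqrt (real n)"

end

theory Submission
  imports Defs
begin

text \<open>
  Write \<open>L h = E exp (h X)\<close> and \<open>K = ln L\<close>, and let \<open>q\<close> be the density of \<open>Z_n\<close> under the
  exponentially tilted probability \<open>exp (h (X_1 + ... + X_n)) / L h ^ n dP\<close>.  Undoing the tilt gives
  \<open>p_n x = L h ^ n * exp (- h * sqrt n * x) * q x\<close> for every admissible \<open>h\<close>.  Only an upper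
  bound is wanted, so no saddle point has to be located: the simple choice \<open>h = x / sqrt n\<close> turns
  the prefactor into \<open>exp (n * K h - x\<^sup>2)\<close>, and \<open>q\<close> is bounded everywhere, by Fourier
  inversion, by the integral of the modulus of its characteristic function divided by \<open>2 pi\<close>.

  \<^item> Taking moduli removes the odd cumulants.  The squared modulus of \<open>E exp ((h + i t) X)\<close> is the
    double integral of \<open>exp (h (X + X')) * cos (t (X - X'))\<close>, and the quartic Taylor bound of the cosine
    gives \<open>|E exp ((h + i t) X) / L h|\<^sup>2 \<le> exp (- K'' h * t\<^sup>2 + D * t ^ 4)\<close> for all \<open>t\<close>
    (\<open>norm_tilted_char_le_gaussian\<close>).  This part of the integral contributes
    \<open>sqrt (2 pi / K'' h) * (1 + O(1/n))\<close>.

  \<^item> For \<open>|t| \<ge> \<delta>\<close> the quotient is at most some \<open>\<theta> < 1\<close>, uniformly for small \<open>h\<close>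
    (\<open>tilted_char_gap\<close>): a law with a density is not supported on a lattice.  Its power \<open>2 n_0\<close> is
    integrable, because the tilted bounded density of \<open>Z_{n_0}\<close> is square integrable
    (\<open>plancherel_inequality\<close>, \<open>tilted_char_square_integrable\<close>).  Hence, for \<open>n \<ge> 2 n_0\<close>, the tail contributes
    \<open>O(sqrt n * \<theta> ^ (n - 2 n_0))\<close>, which is \<open>O(1/n)\<close>.

  Together, \<open>p_n x / \<phi> x \<le> exp (n * (K h - h\<^sup>2 / 2)) * K'' h powr (-1/2) * (1 + C / n)\<close>.  The
  hypotheses on the cumulants say that \<open>K h \<le> h\<^sup>2 / 2 - a * h ^ m\<close> and
  \<open>K'' h \<ge> 1 - C_0 * h ^ (m - 2)\<close> near \<open>0\<close>, with \<open>a > 0\<close> and even \<open>m \<ge> 4\<close>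
  (\<open>cgf_expansion\<close>).  The gain \<open>- a * n * h ^ m\<close> in the exponent beats the loss
  \<open>C_0 * h ^ (m - 2)\<close> once \<open>n * h\<^sup>2\<close> exceeds a constant, and otherwise
  \<open>h ^ (m - 2) \<le> h\<^sup>2 = O(1/n)\<close> (\<open>exponent_tradeoff\<close>).  So the quotient is at most
  \<open>1 + O(1/n)\<close>, and \<open>1 \<le> (ln n / ln 2) ^ 3\<close> for \<open>n \<ge> 2\<close>.
\<close>

section \<open>A Plancherel inequality\<close>

definition fourier_transform :: "(real \<Rightarrow> real) \<Rightarrow> real \<Rightarrow> complex" where
  "fourier_transform u t = (CLINT x|lborel. complex_of_real (u x) * iexp (t * x))"

lemma fourier_transform_measurable [measurable]:
  assumes [measurable]: "u \<in> borel_measurable borel"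
  shows "fourier_transform u \<in> borel_measurable borel"
  unfolding fourier_transform_def[abs_def] by measurable

lemma norm_fourier_transform_le:
  fixes u :: "real \<Rightarrow> real"
  assumes "\<And>x. 0 \<le> u x"
  shows "norm (fourier_transform u t) \<le> (\<integral>x. u x \<partial>lborel)"
  unfolding fourier_transform_def
  by (rule order_trans[OF integral_norm_bound]) (simp add: norm_mult assms)

lemma std_normal_iexp_integral:
  "(CLINT s|lborel. complex_of_real (std_normal_density s) * iexp (s * r)) = complex_of_real (exp (- r\<^sup>2 / 2))"
proof -
  have "(CLINT s|lborel. complex_of_real (std_normal_density s) * iexp (s * r)) = char std_normal_distribution r"
    unfolding char_def by (subst integral_density) (auto simp: scaleR_conv_of_real mult.commute)
  then show ?thesis by (simp add: char_std_normal_distribution)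
qed

lemma integrable_pair_dominated_by_product:
  fixes f g :: "real \<Rightarrow> real" and h :: "real \<times> real \<Rightarrow> complex"
  assumes f: "integrable lborel f" and g: "integrable lborel g"
    and [measurable]: "h \<in> borel_measurable (borel \<Otimes>\<^sub>M borel)"
    and h: "\<And>x y. norm (h (x, y)) \<le> f x * g y"
  shows "integrable (lborel \<Otimes>\<^sub>M lborel) h"
proof -
  have [measurable]: "f \<in> borel_measurable borel" "g \<in> borel_measurable borel"
    using f g by auto
  have "integrable (lborel \<Otimes>\<^sub>M lborel) (\<lambda>(x, y). f x * g y)"
  proof (rule lborel_pair.Fubini_integrable)
    show "integrable lborel (\<lambda>x. \<integral>y. norm (case (x, y) of (x, y) \<Rightarrow> f x * g y) \<partial>lborel)"
      using f g by (simp add: abs_mult)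
  qed (use f g in auto)
  then show ?thesis
  proof (rule Bochner_Integration.integrable_bound)
    show "AE z in lborel \<Otimes>\<^sub>M lborel. norm (h z) \<le> norm (case z of (x, y) \<Rightarrow> f x * g y)"
      using h by (intro AE_I2) (auto intro: order_trans[OF _ abs_ge_self] split: prod.split)
  qed simp
qed

text \<open>
  Expanding the squared modulus and integrating the Gaussian weight first, by Fubini twice, replaces
  the weight by its own characteristic function, which is again a Gaussian.
\<close>

lemma gaussian_weighted_fourier:
  fixes u :: "real \<Rightarrow> real" and k :: real
  assumes u: "integrable lborel u" and pos: "\<And>x. 0 \<le> u x"
  shows "(\<integral>s. std_normal_density s * (norm (fourier_transform u (k * s)))\<^sup>2 \<partial>lborel)
    = (\<integral>x. (\<integral>y. u x * u y * exp (- (k * (x - y))\<^sup>2 / 2) \<partial>lborel) \<partial>lborel)"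
proof -
  have [measurable]: "u \<in> borel_measurable borel" using u by auto
  let ?N = "std_normal_density"
  let ?U = "fourier_transform u"
  have nN: "integrable lborel ?N" by simp
  have inner: "(CLINT s|lborel. complex_of_real (?N s) * (iexp (k * s * x) * cnj (?U (k * s))))
     = complex_of_real (\<integral>y. u y * exp (- (k * (x - y))\<^sup>2 / 2) \<partial>lborel)" for x
  proof -
    have "(CLINT s|lborel. complex_of_real (?N s) * (iexp (k * s * x) * cnj (?U (k * s))))
      = (CLINT s|lborel. CLINT y|lborel. complex_of_real (?N s * u y) * iexp (s * (k * (x - y))))"
    proof (intro Bochner_Integration.integral_cong refl)
      fix s
      have "cnj (?U (k * s)) = (CLINT y|lborel. cnj (complex_of_real (u y) * iexp (k * s * y)))"
        unfolding fourier_transform_def by (rule Bochner_Integration.integral_cnj[symmetric])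
      also have "complex_of_real (?N s) * (iexp (k * s * x) * \<dots>)
        = (CLINT y|lborel. complex_of_real (?N s) * (iexp (k * s * x) * cnj (complex_of_real (u y) * iexp (k * s * y))))"
        by simp
      also have "\<dots> = (CLINT y|lborel. complex_of_real (?N s * u y) * iexp (s * (k * (x - y))))"
      proof (intro Bochner_Integration.integral_cong refl)
        fix y
        have "iexp (s * (k * (x - y))) = iexp (k * s * x) * cnj (iexp (k * s * y))"
          by (simp add: exp_cnj flip: exp_add) (simp add: algebra_simps)
        then show "complex_of_real (?N s) * (iexp (k * s * x) * cnj (complex_of_real (u y) * iexp (k * s * y)))
          = complex_of_real (?N s * u y) * iexp (s * (k * (x - y)))" by simp
      qed
      finally show "complex_of_real (?N s) * (iexp (k * s * x) * cnj (?U (k * s)))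
        = (CLINT y|lborel. complex_of_real (?N s * u y) * iexp (s * (k * (x - y))))" .
    qed
    also have "\<dots> = (CLINT y|lborel. CLINT s|lborel. complex_of_real (?N s * u y) * iexp (s * (k * (x - y))))"
      by (rule lborel_pair.Fubini_integral[symmetric])
         (rule integrable_pair_dominated_by_product[OF nN u],
          auto simp: case_prod_beta' norm_mult abs_mult pos)
    also have "\<dots> = (CLINT y|lborel. complex_of_real (u y * exp (- (k * (x - y))\<^sup>2 / 2)))"
    proof (intro Bochner_Integration.integral_cong refl)
      fix y
      have "(CLINT s|lborel. complex_of_real (?N s * u y) * iexp (s * (k * (x - y))))
        = (CLINT s|lborel. complex_of_real (u y) * (complex_of_real (?N s) * iexp (s * (k * (x - y)))))"
        by (simp add: mult_ac)
      also have "\<dots> = complex_of_real (u y * exp (- (k * (x - y))\<^sup>2 / 2))"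
        by (simp add: std_normal_iexp_integral del: of_real_mult flip: of_real_mult)
      finally show "(CLINT s|lborel. complex_of_real (?N s * u y) * iexp (s * (k * (x - y))))
        = complex_of_real (u y * exp (- (k * (x - y))\<^sup>2 / 2))" .
    qed
    finally show ?thesis by (simp only: integral_complex_of_real)
  qed
  have "complex_of_real (\<integral>s. ?N s * (norm (?U (k * s)))\<^sup>2 \<partial>lborel)
    = (CLINT s|lborel. CLINT x|lborel. complex_of_real (?N s * u x) * (iexp (k * s * x) * cnj (?U (k * s))))"
    unfolding integral_complex_of_real[symmetric]
  proof (intro Bochner_Integration.integral_cong refl)
    fix s
    have "complex_of_real (?N s * (norm (?U (k * s)))\<^sup>2) = complex_of_real (?N s) * cnj (?U (k * s)) * ?U (k * s)"
      by (simp only: of_real_mult complex_norm_square mult_ac)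
    also have "\<dots> = (CLINT x|lborel. complex_of_real (?N s) * cnj (?U (k * s)) * (complex_of_real (u x) * iexp (k * s * x)))"
      unfolding fourier_transform_def[of u "k * s"] by simp
    finally show "complex_of_real (?N s * (norm (?U (k * s)))\<^sup>2)
      = (CLINT x|lborel. complex_of_real (?N s * u x) * (iexp (k * s * x) * cnj (?U (k * s))))"
      by (simp add: mult_ac)
  qed
  also have "\<dots> = (CLINT x|lborel. CLINT s|lborel. complex_of_real (?N s * u x) * (iexp (k * s * x) * cnj (?U (k * s))))"
  proof (rule lborel_pair.Fubini_integral[symmetric])
    have [measurable]: "cnj \<in> borel_measurable borel"
      by (intro borel_measurable_continuous_onI continuous_intros)
    show "integrable (lborel \<Otimes>\<^sub>M lborel)
      (\<lambda>(s, x). complex_of_real (?N s * u x) * (iexp (k * s * x) * cnj (?U (k * s))))"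
    proof (rule integrable_pair_dominated_by_product[OF nN integrable_mult_right[OF u, of "\<integral>x. u x \<partial>lborel"]])
      fix s x
      show "norm (case (s, x) of (s, x) \<Rightarrow> complex_of_real (?N s * u x) * (iexp (k * s * x) * cnj (?U (k * s))))
         \<le> ?N s * ((\<integral>x. u x \<partial>lborel) * u x)"
        using norm_fourier_transform_le[of u "k * s", OF pos] pos[of x]
        by (simp add: norm_mult abs_mult mult.assoc mult.commute[of "u x"] mult_left_mono mult_right_mono)
    qed measurable
  qed
  also have "\<dots> = (CLINT x|lborel. complex_of_real (u x * (\<integral>y. u y * exp (- (k * (x - y))\<^sup>2 / 2) \<partial>lborel)))"
  proof (intro Bochner_Integration.integral_cong refl)
    fix x
    have "(CLINT s|lborel. complex_of_real (?N s * u x) * (iexp (k * s * x) * cnj (?U (k * s))))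
      = complex_of_real (u x) * (CLINT s|lborel. complex_of_real (?N s) * (iexp (k * s * x) * cnj (?U (k * s))))"
      by (subst integral_mult_right_zero[symmetric]) (simp add: mult_ac)
    then show "(CLINT s|lborel. complex_of_real (?N s * u x) * (iexp (k * s * x) * cnj (?U (k * s))))
      = complex_of_real (u x * (\<integral>y. u y * exp (- (k * (x - y))\<^sup>2 / 2) \<partial>lborel))"
      by (simp only: inner) (simp only: of_real_mult)
  qed
  finally show ?thesis
    by (simp only: integral_complex_of_real of_real_eq_iff) (simp add: mult.assoc)
qed

lemma gaussian_kernel_mass:
  fixes k :: real
  assumes "0 < k"
  shows "(\<integral>\<^sup>+y. ennreal (exp (- (k * (x - y))\<^sup>2 / 2)) \<partial>lborel) = ennreal (sqrt (2 * pi) / k)"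
proof -
  have sq: "sqrt (2 * pi * (1 / k)\<^sup>2) = sqrt (2 * pi) / k"
    using assms by (simp add: real_sqrt_mult real_sqrt_divide power_divide)
  have ex: "- (k * (x - y))\<^sup>2 / 2 = - (y - x)\<^sup>2 / (2 * (1 / k)\<^sup>2)" for y
    using assms by (simp add: field_simps power2_eq_square)
  have "exp (- (k * (x - y))\<^sup>2 / 2) = sqrt (2 * pi) / k * normal_density x (1 / k) y" for y
    using assms unfolding normal_density_def sq ex by simp
  then have "(\<integral>\<^sup>+y. ennreal (exp (- (k * (x - y))\<^sup>2 / 2)) \<partial>lborel)
     = (\<integral>\<^sup>+y. ennreal (sqrt (2 * pi) / k * normal_density x (1 / k) y) \<partial>lborel)" by simp
  also have "\<dots> = ennreal (\<integral>y. sqrt (2 * pi) / k * normal_density x (1 / k) y \<partial>lborel)"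
    using assms by (intro nn_integral_eq_integral) auto
  finally show ?thesis using assms by simp
qed

text \<open>
  By \<open>u x * u y \<le> ((u x)\<^sup>2 + (u y)\<^sup>2) / 2\<close> and symmetry, the form is at most the kernel mass
  times the integral of \<open>u\<^sup>2\<close>.
\<close>

lemma gaussian_quadratic_form_le:
  fixes u :: "real \<Rightarrow> real" and k :: real
  assumes u: "integrable lborel u" and u2: "integrable lborel (\<lambda>x. (u x)\<^sup>2)" and pos: "\<And>x. 0 \<le> u x"
    and k: "0 < k"
  shows "(\<integral>x. (\<integral>y. u x * u y * exp (- (k * (x - y))\<^sup>2 / 2) \<partial>lborel) \<partial>lborel)
     \<le> sqrt (2 * pi) / k * (\<integral>x. (u x)\<^sup>2 \<partial>lborel)"
proof -
  have [measurable]: "u \<in> borel_measurable borel" using u by auto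
  define g where "g x y = exp (- (k * (x - y))\<^sup>2 / 2)" for x y
  have [measurable]: "(\<lambda>z. g (fst z) (snd z)) \<in> borel_measurable (borel \<Otimes>\<^sub>M borel)"
    "g x \<in> borel_measurable borel" for x
    unfolding g_def by measurable
  have g0: "0 \<le> g x y" and g1: "g x y \<le> 1" and gsym: "g x y = g y x" for x y
    by (auto simp: g_def power_mult_distrib power2_commute)
  have gmass: "(\<integral>\<^sup>+y. ennreal (g x y) \<partial>lborel) = ennreal (sqrt (2 * pi) / k)" for x
    unfolding g_def by (rule gaussian_kernel_mass[OF k])
  let ?J = "\<integral>\<^sup>+x. ennreal ((u x)\<^sup>2) \<partial>lborel"
  let ?c = "ennreal (sqrt (2 * pi) / k)"
  have J: "?J = ennreal (\<integral>x. (u x)\<^sup>2 \<partial>lborel)"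
    using u2 by (intro nn_integral_eq_integral) auto
  have part1: "(\<integral>\<^sup>+x. (\<integral>\<^sup>+y. ennreal ((u x)\<^sup>2) * ennreal (g x y) \<partial>lborel) \<partial>lborel) = ?J * ?c"
    by (simp add: nn_integral_cmult gmass nn_integral_multc)
  have part2: "(\<integral>\<^sup>+x. (\<integral>\<^sup>+y. ennreal ((u y)\<^sup>2) * ennreal (g x y) \<partial>lborel) \<partial>lborel) = ?J * ?c"
  proof -
    have "(\<integral>\<^sup>+x. (\<integral>\<^sup>+y. ennreal ((u y)\<^sup>2) * ennreal (g x y) \<partial>lborel) \<partial>lborel)
       = (\<integral>\<^sup>+y. (\<integral>\<^sup>+x. ennreal ((u y)\<^sup>2) * ennreal (g x y) \<partial>lborel) \<partial>lborel)"
      by (rule lborel_pair.Fubini'[symmetric]) (simp add: case_prod_beta')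
    also have "\<dots> = (\<integral>\<^sup>+y. (\<integral>\<^sup>+x. ennreal ((u y)\<^sup>2) * ennreal (g y x) \<partial>lborel) \<partial>lborel)"
      by (subst gsym) simp
    also have "\<dots> = ?J * ?c" by (rule part1)
    finally show ?thesis .
  qed
  have ineq: "u x * u y * g x y \<le> (u x)\<^sup>2 / 2 * g x y + (u y)\<^sup>2 / 2 * g x y" for x y
  proof -
    have "u x * u y \<le> (u x)\<^sup>2 / 2 + (u y)\<^sup>2 / 2"
      using sum_squares_bound[of "u x" "u y"] by simp
    from mult_right_mono[OF this g0, of x y] show ?thesis by (simp add: distrib_right)
  qed
  have int_in: "integrable lborel (\<lambda>y. u x * u y * g x y)" for x
    by (rule Bochner_Integration.integrable_bound[OF integrable_mult_right[OF u, of "u x"]])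
       (auto simp: abs_mult pos g0 g1 mult_left_le)
  have le: "ennreal (\<integral>y. u x * u y * g x y \<partial>lborel) = (\<integral>\<^sup>+y. ennreal (u x * u y * g x y) \<partial>lborel)" for x
    by (rule nn_integral_eq_integral[symmetric, OF int_in]) (simp add: pos g0)
  have cm: "(\<integral>\<^sup>+x. (\<integral>\<^sup>+y. ennreal (1/2) * f x y \<partial>lborel) \<partial>lborel)
      = ennreal (1/2) * (\<integral>\<^sup>+x. (\<integral>\<^sup>+y. f x y \<partial>lborel) \<partial>lborel)"
    if [measurable]: "(\<lambda>z. f (fst z) (snd z)) \<in> borel_measurable (borel \<Otimes>\<^sub>M borel)" for f :: "real \<Rightarrow> real \<Rightarrow> ennreal"
  proof -
    have [measurable]: "f x \<in> borel_measurable borel" for x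
      using measurable_compose[OF measurable_Pair1' that, of x] by simp
    show ?thesis by (simp add: nn_integral_cmult)
  qed
  have half: "ennreal (a / 2 * b) = ennreal (1/2) * (ennreal a * ennreal b)" if "0 \<le> a" "0 \<le> b" for a b :: real
  proof -
    have "ennreal (a / 2 * b) = ennreal (1/2 * (a * b))" by simp
    also have "\<dots> = ennreal (1/2) * ennreal (a * b)" using that by (intro ennreal_mult) auto
    finally show ?thesis using that by (simp only: ennreal_mult)
  qed
  have "ennreal (\<integral>x. (\<integral>y. u x * u y * g x y \<partial>lborel) \<partial>lborel)
      \<le> (\<integral>\<^sup>+x. ennreal (\<integral>y. u x * u y * g x y \<partial>lborel) \<partial>lborel)"
  proof (cases "integrable lborel (\<lambda>x. \<integral>y. u x * u y * g x y \<partial>lborel)")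
    case True
    then show ?thesis by (subst nn_integral_eq_integral) (auto intro!: integral_nonneg_AE simp: pos g0)
  qed (simp add: not_integrable_integral_eq)
  also have "\<dots> = (\<integral>\<^sup>+x. (\<integral>\<^sup>+y. ennreal (u x * u y * g x y) \<partial>lborel) \<partial>lborel)" by (simp add: le)
  also have "\<dots> \<le> (\<integral>\<^sup>+x. (\<integral>\<^sup>+y. ennreal ((u x)\<^sup>2 / 2 * g x y) + ennreal ((u y)\<^sup>2 / 2 * g x y) \<partial>lborel) \<partial>lborel)"
    by (intro nn_integral_mono) (subst ennreal_plus[symmetric], auto intro!: ennreal_leI simp: g0 ineq[simplified] simp del: ennreal_plus)
  also have "\<dots> = (\<integral>\<^sup>+x. (\<integral>\<^sup>+y. ennreal ((u x)\<^sup>2 / 2 * g x y) \<partial>lborel) \<partial>lborel)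
      + (\<integral>\<^sup>+x. (\<integral>\<^sup>+y. ennreal ((u y)\<^sup>2 / 2 * g x y) \<partial>lborel) \<partial>lborel)"
    by (simp add: nn_integral_add)
  also have "\<dots> = ennreal (1/2) * (?J * ?c) + ennreal (1/2) * (?J * ?c)"
    unfolding half[OF zero_le_power2 g0]
    using cm[of "\<lambda>x y. ennreal ((u x)\<^sup>2) * ennreal (g x y)"] cm[of "\<lambda>x y. ennreal ((u y)\<^sup>2) * ennreal (g x y)"]
    by (simp only: part1 part2) measurable
  also have "\<dots> = ?J * ?c"
  proof -
    have "ennreal (1/2) + ennreal (1/2) = 1" by (subst ennreal_plus[symmetric]) auto
    then show ?thesis by (simp only: distrib_right[symmetric] mult_1)
  qed
  also have "\<dots> = ennreal (sqrt (2 * pi) / k * (\<integral>x. (u x)\<^sup>2 \<partial>lborel))"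
    using k by (simp add: J ennreal_mult[symmetric] mult.commute)
  finally show ?thesis
    using k unfolding g_def by (subst (asm) ennreal_le_iff) auto
qed

text \<open>
  The Gaussian weight with variance \<open>k\<^sup>2\<close> makes all integrals absolutely convergent and leaves a
  bound that does not depend on \<open>k\<close>.  Fatou's lemma removes the weight as \<open>k \<rightarrow> \<infinity>\<close>.
\<close>

lemma plancherel_inequality:
  fixes u :: "real \<Rightarrow> real"
  assumes u: "integrable lborel u" and u2: "integrable lborel (\<lambda>x. (u x)\<^sup>2)" and pos: "\<And>x. 0 \<le> u x"
  shows "integrable lborel (\<lambda>t. (norm (fourier_transform u t))\<^sup>2)"
    and "(\<integral>t. (norm (fourier_transform u t))\<^sup>2 \<partial>lborel) \<le> 2 * pi * (\<integral>x. (u x)\<^sup>2 \<partial>lborel)"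
proof -
  have [measurable]: "u \<in> borel_measurable borel" using u by auto
  let ?U = "fourier_transform u"
  let ?J = "\<integral>x. (u x)\<^sup>2 \<partial>lborel"
  let ?A = "\<integral>x. u x \<partial>lborel"
  have bnd: "(norm (?U t))\<^sup>2 \<le> ?A\<^sup>2" for t
    by (intro power_mono norm_fourier_transform_le pos) auto
  have J0: "0 \<le> ?J" by simp
  have step: "(\<integral>\<^sup>+t. ennreal (exp (- (t / k)\<^sup>2 / 2) * (norm (?U t))\<^sup>2) \<partial>lborel) \<le> ennreal (2 * pi * ?J)"
    if k: "0 < k" for k :: real
  proof -
    have int: "integrable lborel (\<lambda>s. std_normal_density s * (norm (?U (k * s)))\<^sup>2)"
      by (rule Bochner_Integration.integrable_bound[where f="\<lambda>s. ?A\<^sup>2 * std_normal_density s"])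
         (auto simp: abs_mult mult.commute[of "?A\<^sup>2"] intro!: mult_left_mono bnd)
    have "(\<integral>\<^sup>+t. ennreal (exp (- (t / k)\<^sup>2 / 2) * (norm (?U t))\<^sup>2) \<partial>lborel)
      = ennreal k * (\<integral>\<^sup>+s. ennreal (exp (- s\<^sup>2 / 2) * (norm (?U (k * s)))\<^sup>2) \<partial>lborel)"
      using k by (subst nn_integral_real_affine[where c=k and t=0]) auto
    also have "\<dots> = ennreal k * (\<integral>\<^sup>+s. ennreal (sqrt (2 * pi)) * ennreal (std_normal_density s * (norm (?U (k * s)))\<^sup>2) \<partial>lborel)"
      by (simp add: std_normal_density_def ennreal_mult[symmetric])
    also have "\<dots> = ennreal k * (ennreal (sqrt (2 * pi)) * (\<integral>\<^sup>+s. ennreal (std_normal_density s * (norm (?U (k * s)))\<^sup>2) \<partial>lborel))"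
      by (subst nn_integral_cmult) auto
    also have "\<dots> = ennreal (k * (sqrt (2 * pi) * (\<integral>s. std_normal_density s * (norm (?U (k * s)))\<^sup>2 \<partial>lborel)))"
      using k by (subst nn_integral_eq_integral[OF int]) (auto simp: ennreal_mult[symmetric])
    also have "\<dots> \<le> ennreal (k * (sqrt (2 * pi) * (sqrt (2 * pi) / k * ?J)))"
      using k gaussian_quadratic_form_le[OF u u2 pos k]
      by (intro ennreal_leI mult_left_mono) (auto simp: gaussian_weighted_fourier[OF u pos])
    also have "k * (sqrt (2 * pi) * (sqrt (2 * pi) / k * ?J)) = 2 * pi * ?J"
      using k by (simp add: field_simps)
    finally show ?thesis .
  qed
  have lim: "(\<lambda>n. ennreal (exp (- (t / real (Suc n))\<^sup>2 / 2) * (norm (?U t))\<^sup>2)) \<longlonglongrightarrow> ennreal ((norm (?U t))\<^sup>2)" for t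
  proof -
    have "(\<lambda>n. t / real (Suc n)) \<longlonglongrightarrow> 0" by real_asymp
    then have "(\<lambda>n. exp (- (t / real (Suc n))\<^sup>2 / 2) * (norm (?U t))\<^sup>2) \<longlonglongrightarrow> exp (- 0\<^sup>2 / 2) * (norm (?U t))\<^sup>2"
      by (intro tendsto_intros) auto
    then show ?thesis by (intro tendsto_ennrealI) simp
  qed
  have "(\<integral>\<^sup>+t. ennreal ((norm (?U t))\<^sup>2) \<partial>lborel)
     = (\<integral>\<^sup>+t. liminf (\<lambda>n. ennreal (exp (- (t / real (Suc n))\<^sup>2 / 2) * (norm (?U t))\<^sup>2)) \<partial>lborel)"
    by (intro nn_integral_cong) (metis lim lim_imp_Liminf sequentially_bot)
  also have "\<dots> \<le> liminf (\<lambda>n. \<integral>\<^sup>+t. ennreal (exp (- (t / real (Suc n))\<^sup>2 / 2) * (norm (?U t))\<^sup>2) \<partial>lborel)"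
    by (rule nn_integral_liminf) measurable
  also have "\<dots> \<le> liminf (\<lambda>n::nat. ennreal (2 * pi * ?J))"
    by (intro Liminf_mono always_eventually allI step) simp
  also have "\<dots> = ennreal (2 * pi * ?J)" by (simp add: Liminf_const)
  finally have fin: "(\<integral>\<^sup>+t. ennreal ((norm (?U t))\<^sup>2) \<partial>lborel) \<le> ennreal (2 * pi * ?J)" .
  show int: "integrable lborel (\<lambda>t. (norm (?U t))\<^sup>2)"
    using fin by (intro integrableI_bounded) (auto simp: less_top[symmetric] top_unique)
  show "(\<integral>t. (norm (?U t))\<^sup>2 \<partial>lborel) \<le> 2 * pi * ?J"
    using fin J0 by (subst (asm) nn_integral_eq_integral[OF int]) (auto simp: ennreal_le_iff)
qed

section \<open>Fourier inversion\<close>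

text \<open>
  Levy's inversion formula gives the mass of intervals whose endpoints are not atoms.  Since the
  characteristic function is integrable, the limit in that formula is an absolutely convergent integral,
  and Fubini turns it into the integral of a bounded continuous function \<open>q\<close> over the interval.
  An atom at \<open>c\<close> would contradict this bound on short intervals around \<open>c\<close>, whose endpoints can be
  chosen among the non-atoms because there are only countably many atoms.  So the formula holds for all
  intervals; it forces \<open>q\<close> to be nonnegative and determines the law.
\<close>

theorem (in real_distribution) fourier_inversion_density:
  assumes int: "integrable lborel (char M)"
  obtains q :: "real \<Rightarrow> real"
  where "M = density lborel q" "continuous_on UNIV q" "\<And>y. 0 \<le> q y"
    "\<And>y. q y \<le> (\<integral>t. norm (char M t) \<partial>lborel) / (2 * pi)"
proof -
  let ?\<phi> = "char M"
  define C where "C = (\<integral>t. norm (?\<phi> t) \<partial>lborel) / (2 * pi)"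
  have C0: "0 \<le> C" by (simp add: C_def)
  have intn: "integrable lborel (\<lambda>t. norm (?\<phi> t))" using int by simp
  define Q where "Q y = (CLINT t|lborel. iexp (- (t * y)) * ?\<phi> t) / (2 * pi)" for y
  define q where "q y = Re (Q y)" for y
  have int_y: "integrable lborel (\<lambda>t. iexp (- (t * y)) * ?\<phi> t)" for y
    by (rule Bochner_Integration.integrable_bound[OF int]) (auto simp: norm_mult)
  have Qbound: "norm (Q y) \<le> C" for y
  proof -
    have "norm (CLINT t|lborel. iexp (- (t * y)) * ?\<phi> t) \<le> (\<integral>t. norm (?\<phi> t) \<partial>lborel)"
      by (rule order_trans[OF integral_norm_bound]) (simp add: norm_mult)
    then show ?thesis by (simp add: Q_def C_def norm_divide divide_right_mono)
  qed
  have Qcont: "isCont Q y" for y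
    unfolding Q_def[abs_def]
  proof (intro continuous_intros)
    show "isCont (\<lambda>y. CLINT t|lborel. iexp (- (t * y)) * ?\<phi> t) y"
      unfolding continuous_at_sequentially comp_def
    proof safe
      fix X assume X: "X \<longlonglongrightarrow> y"
      show "(\<lambda>n. CLINT t|lborel. iexp (- (t * X n)) * ?\<phi> t) \<longlonglongrightarrow> (CLINT t|lborel. iexp (- (t * y)) * ?\<phi> t)"
        by (rule integral_dominated_convergence[where w="\<lambda>t. norm (?\<phi> t)"])
           (use intn X in \<open>auto simp: norm_mult intro!: tendsto_intros\<close>)
    qed
  qed simp
  have qcont: "continuous_on UNIV q"
    unfolding q_def[abs_def] using Qcont by (intro continuous_intros) (simp add: continuous_on_eq_continuous_at)
  have qbound: "\<bar>q y\<bar> \<le> C" for y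
    unfolding q_def by (rule order_trans[OF abs_Re_le_cmod Qbound])
  have [measurable]: "q \<in> borel_measurable borel" using qcont by (rule borel_measurable_continuous_onI)
  have intq: "integrable lborel (\<lambda>y. indicator {a..b} y * q y)" for a b
    using borel_integrable_atLeastAtMost'[of a b q] continuous_on_subset[OF qcont]
    by (simp add: set_integrable_def)
  have int_ind: "integrable lborel (\<lambda>y. indicator {a..b} y * c)" for a b c :: real
    by (intro integrable_mult_left integrable_real_indicator) (auto simp: emeasure_lborel_Icc_eq)
  have interval: "measure M {a<..b} = (\<integral>y. indicator {a..b} y * q y \<partial>lborel)"
    if ab: "a \<le> b" and atoms: "measure M {a} = 0" "measure M {b} = 0" for a b
  proof -
    define F where "F t = (iexp (- (t * a)) - iexp (- (t * b))) / (\<i> * t)" for t :: real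
    have [measurable]: "F \<in> borel_measurable borel" unfolding F_def by measurable
    have Fint: "F t = (CLINT y|lborel. indicator {a..b} y *\<^sub>R iexp (- (t * y)))" if "t \<noteq> 0" for t
    proof -
      have "(CLINT y|lborel. indicator {a..b} y *\<^sub>R iexp (- (t * y)))
          = iexp (- (t * b)) * (\<i> / t) - iexp (- (t * a)) * (\<i> / t)"
      proof (rule integral_FTC_atLeastAtMost[OF ab])
        fix x
        have "((\<lambda>x. exp (\<i> * complex_of_real (- (t * x))) * (\<i> / t)) has_vector_derivative iexp (- (t * x))) (at x)"
        proof -
          have "((\<lambda>z. exp (\<i> * (- (t * z))) * (\<i> / t)) has_field_derivative exp (\<i> * (- (t * x)))) (at (complex_of_real x))"
            using that by (auto intro!: derivative_eq_intros)
          from field_differentiable_diff has_vector_derivative_real_field[OF this] show ?thesis by simp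
        qed
        then show "((\<lambda>x. iexp (- (t * x)) * (\<i> / t)) has_vector_derivative iexp (- (t * x))) (at x within {a..b})"
          by (rule has_vector_derivative_at_within)
      qed (intro continuous_intros)
      moreover have "\<i> / complex_of_real t = - (1 / (\<i> * t))"
        by (metis divide_minus_left i_squared mult_divide_mult_cancel_left complex_i_not_zero power2_eq_square power2_i)
      ultimately show ?thesis by (simp add: F_def diff_divide_distrib)
    qed
    have Fle: "norm (F t * ?\<phi> t) \<le> (b - a) * norm (?\<phi> t)" for t
    proof (cases "t = 0")
      case False
      have "norm (F t) \<le> b - a"
        using Levy_Inversion_aux2[of "-b" "-a" t] ab False by (simp add: F_def)
      then show ?thesis by (simp add: norm_mult mult_right_mono)
    qed (use ab in \<open>auto simp: F_def\<close>)
    have levy: "(\<lambda>T::nat. 1 / (2 * pi) * (CLINT t|lborel. indicator {- real T<..<real T} t *\<^sub>R (F t * ?\<phi> t)))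
        \<longlonglongrightarrow> complex_of_real (measure M {a<..b})"
      using Levy_Inversion[OF ab atoms, folded F_def]
      by (simp add: interval_lebesgue_integral_def set_lebesgue_integral_def)
    have "(\<lambda>T::nat. 1 / (2 * pi) * (CLINT t|lborel. indicator {- real T<..<real T} t *\<^sub>R (F t * ?\<phi> t)))
        \<longlonglongrightarrow> 1 / (2 * pi) * (CLINT t|lborel. F t * ?\<phi> t)"
    proof (rule tendsto_mult_left)
      show "(\<lambda>T::nat. CLINT t|lborel. indicator {- real T<..<real T} t *\<^sub>R (F t * ?\<phi> t)) \<longlonglongrightarrow> (CLINT t|lborel. F t * ?\<phi> t)"
      proof (rule integral_dominated_convergence[where w="\<lambda>t. (b - a) * norm (?\<phi> t)"])
        show "AE t in lborel. (\<lambda>T::nat. indicator {- real T<..<real T} t *\<^sub>R (F t * ?\<phi> t)) \<longlonglongrightarrow> F t * ?\<phi> t"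
        proof (intro AE_I2 tendsto_eventually)
          fix t :: real
          obtain N :: nat where "\<bar>t\<bar> < real N" using reals_Archimedean2 by blast
          then show "\<forall>\<^sub>F T::nat in sequentially. indicator {- real T<..<real T} t *\<^sub>R (F t * ?\<phi> t) = F t * ?\<phi> t"
            by (intro eventually_sequentiallyI[of N]) (auto simp: indicator_def abs_less_iff)
        qed
        show "AE t in lborel. norm (indicator {- real T<..<real T} t *\<^sub>R (F t * ?\<phi> t)) \<le> (b - a) * norm (?\<phi> t)" for T :: nat
          using Fle ab by (intro AE_I2) (auto simp: indicator_def)
      qed (auto intro!: integrable_mult_right intn)
    qed
    from LIMSEQ_unique[OF levy this]
    have "complex_of_real (measure M {a<..b}) = 1 / (2 * pi) * (CLINT t|lborel. F t * ?\<phi> t)" .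
    also have "(CLINT t|lborel. F t * ?\<phi> t)
        = (CLINT t|lborel. CLINT y|lborel. indicator {a..b} y *\<^sub>R (iexp (- (t * y)) * ?\<phi> t))"
    proof (intro integral_cong_AE)
      have "AE t in lborel. t \<noteq> (0::real)" by (rule AE_lborel_singleton)
      then show "AE t in lborel. F t * ?\<phi> t
          = (CLINT y|lborel. indicator {a..b} y *\<^sub>R (iexp (- (t * y)) * ?\<phi> t))"
      proof eventually_elim
        case (elim t)
        show ?case unfolding Fint[OF elim] integral_mult_left_zero[symmetric] by simp
      qed
    qed measurable
    also have "\<dots> = (CLINT y|lborel. CLINT t|lborel. indicator {a..b} y *\<^sub>R (iexp (- (t * y)) * ?\<phi> t))"
      by (rule lborel_pair.Fubini_integral[symmetric],
          rule integrable_pair_dominated_by_product[OF intn, where g="indicator {a..b}"])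
         (auto simp: norm_mult case_prod_beta' split: split_indicator intro!: integrable_real_indicator simp: emeasure_lborel_Icc_eq)
    also have "1 / (2 * pi) * \<dots> = (CLINT y|lborel. indicator {a..b} y *\<^sub>R Q y)"
      by (simp add: Q_def flip: integral_mult_right_zero integral_divide_zero)
    finally have "measure M {a<..b} = Re (CLINT y|lborel. indicator {a..b} y *\<^sub>R Q y)"
      by (metis Re_complex_of_real)
    also have "\<dots> = (\<integral>y. Re (indicator {a..b} y *\<^sub>R Q y) \<partial>lborel)"
    proof (rule integral_Re[symmetric])
      show "integrable lborel (\<lambda>y. indicator {a..b} y *\<^sub>R Q y)"
        using borel_integrable_atLeastAtMost'[of a b Q] Qcont
        by (simp add: set_integrable_def continuous_at_imp_continuous_on)
    qed
    finally show ?thesis by (simp add: q_def)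
  qed
  have le_C: "(\<integral>y. indicator {a..b} y * q y \<partial>lborel) \<le> C * (b - a)" if "a \<le> b" for a b
  proof -
    have "(\<integral>y. indicator {a..b} y * q y \<partial>lborel) \<le> (\<integral>y. indicator {a..b} y * C \<partial>lborel)"
      using qbound by (intro integral_mono intq int_ind) (auto simp: abs_le_iff split: split_indicator)
    then show ?thesis using that by (simp add: mult.commute)
  qed
  have no_atoms: "measure M {c} = 0" for c
  proof (rule ccontr)
    assume "measure M {c} \<noteq> 0"
    then have pos: "0 < measure M {c}" using measure_nonneg[of M "{c}"] by linarith
    \<comment> \<open>chosen so that an interval of length \<open>2 * e\<close> has mass at most two thirds of the atom\<close>
    define e where "e = measure M {c} / (3 * (C + 1))"
    have e: "0 < e" using pos C0 by (simp add: e_def)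
    have cnt: "countable {x. measure M {x} \<noteq> 0}" by (rule countable_support)
    obtain a where a: "a \<in> {c - e<..<c}" "measure M {a} = 0"
      using open_minus_countable[OF cnt, of "{c - e<..<c}"] e by auto
    obtain b where b: "b \<in> {c<..<c + e}" "measure M {b} = 0"
      using open_minus_countable[OF cnt, of "{c<..<c + e}"] e by auto
    have "measure M {c} \<le> measure M {a<..b}"
      using a b by (intro finite_measure_mono) auto
    also have "\<dots> \<le> C * (b - a)"
      using a b interval[of a b] le_C[of a b] by simp
    also have "\<dots> \<le> (C + 1) * (2 * e)"
      using a b C0 by (intro mult_mono) auto
    also have "\<dots> = 2 / 3 * measure M {c}" using C0 by (simp add: e_def field_simps)
    finally show False using pos by linarith
  qed
  have qnonneg: "0 \<le> q y" for y
  proof (rule ccontr)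
    assume neg: "\<not> 0 \<le> q y"
    have "isCont q y" using qcont by (simp add: continuous_on_eq_continuous_at)
    then have "\<exists>d>0. \<forall>x. dist x y < d \<longrightarrow> dist (q x) (q y) < - q y / 2"
      unfolding continuous_at_eps_delta using neg by (auto dest!: spec[of _ "- q y / 2"])
    then obtain d where d: "0 < d" "\<And>x. dist x y < d \<Longrightarrow> dist (q x) (q y) < - q y / 2" by auto
    have "(\<integral>x. indicator {y..y + d / 2} x * q x \<partial>lborel) \<le> (\<integral>x. indicator {y..y + d / 2} x * (q y / 2) \<partial>lborel)"
    proof (intro integral_mono intq int_ind)
      fix x show "indicator {y..y + d / 2} x * q x \<le> indicator {y..y + d / 2} x * (q y / 2)"
        using d(1) d(2)[of x] by (auto simp: dist_real_def abs_less_iff split: split_indicator)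
    qed
    also have "\<dots> = d * q y / 4" using d(1) by simp
    also have "\<dots> < 0" using neg d(1) by (simp add: mult_pos_neg)
    finally show False using interval[of y "y + d / 2"] no_atoms d(1) measure_nonneg[of M "{y<..y + d / 2}"] by simp
  qed
  have "M = density lborel q"
  proof (rule measure_eqI_generator_eq[where \<Omega>=UNIV and E="range (\<lambda>(a, b). {a<..b})" and A="\<lambda>n. {- real n<..real n}"])
    show "Int_stable (range (\<lambda>(a, b::real). {a<..b}))"
    proof (rule Int_stableI_image)
      fix i j :: "real \<times> real"
      have "(case i of (a, b) \<Rightarrow> {a<..b}) \<inter> (case j of (a, b) \<Rightarrow> {a<..b})
          = (case (max (fst i) (fst j), min (snd i) (snd j)) of (a, b) \<Rightarrow> {a<..b})"
        by (auto split: prod.split)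
      then show "\<exists>k\<in>UNIV. (case i of (a, b) \<Rightarrow> {a<..b}) \<inter> (case j of (a, b) \<Rightarrow> {a<..b})
          = (case k of (a, b) \<Rightarrow> {a<..b})" by blast
    qed
    have borel: "sets borel = sigma_sets UNIV (range (\<lambda>(a, b::real). {a<..b}))"
      by (subst borel_sigma_sets_Ioc) (rule sets_measure_of, simp)
    show "sets M = sigma_sets UNIV (range (\<lambda>(a, b). {a<..b}))"
      unfolding borel[symmetric] by simp
    show "sets (density lborel q) = sigma_sets UNIV (range (\<lambda>(a, b). {a<..b}))"
      unfolding borel[symmetric] by simp
    show "range (\<lambda>n. {- real n<..real n}) \<subseteq> range (\<lambda>(a, b). {a<..b})" by auto
    show "(\<Union>n. {- real n<..real n}) = UNIV"
    proof (intro set_eqI iffI UNIV_I)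
      fix x :: real
      obtain n :: nat where "\<bar>x\<bar> < real n" using reals_Archimedean2 by blast
      then have "x \<in> {- real n<..real n}" by (auto simp: abs_less_iff)
      then show "x \<in> (\<Union>n. {- real n<..real n})" by blast
    qed
    show "emeasure M {- real n<..real n} \<noteq> \<infinity>" for n by simp
  next
    fix X assume "X \<in> range (\<lambda>(a, b::real). {a<..b})"
    then obtain a b where X: "X = {a<..b}" by auto
    show "emeasure M X = emeasure (density lborel q) X"
    proof (cases "a \<le> b")
      case True
      have "emeasure (density lborel q) X = (\<integral>\<^sup>+y. ennreal (indicator {a..b} y * q y) \<partial>lborel)"
      proof -
        have "emeasure (density lborel q) X = (\<integral>\<^sup>+y. ennreal (q y) * indicator {a<..b} y \<partial>lborel)"
          unfolding X by (rule emeasure_density) auto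
        also have "\<dots> = (\<integral>\<^sup>+y. ennreal (indicator {a..b} y * q y) \<partial>lborel)"
        proof (rule nn_integral_cong_AE)
          have "AE y in lborel. y \<noteq> a" by (rule AE_lborel_singleton)
          then show "AE y in lborel. ennreal (q y) * indicator {a<..b} y = ennreal (indicator {a..b} y * q y)"
            by eventually_elim (auto split: split_indicator)
        qed
        finally show ?thesis .
      qed
      also have "\<dots> = ennreal (\<integral>y. indicator {a..b} y * q y \<partial>lborel)"
        by (rule nn_integral_eq_integral[OF intq]) (simp add: qnonneg)
      also have "\<dots> = emeasure M X"
        using interval[OF True no_atoms no_atoms] by (simp add: X emeasure_eq_measure)
      finally show ?thesis by simp
    qed (simp add: X)
  qed simp
  with qcont qnonneg qbound show thesis
    by (intro that[of q]) (auto simp: abs_le_iff C_def)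
qed

text \<open>
  The set where two continuous functions differ is open, and nonempty open sets are not null.
\<close>

lemma continuous_eq_if_AE_eq:
  fixes f g :: "real \<Rightarrow> real"
  assumes f: "continuous_on UNIV f" and g: "continuous_on UNIV g" and ae: "AE x in lborel. f x = g x"
  shows "f = g"
proof (rule ccontr)
  assume ne: "f \<noteq> g"
  let ?S = "{x. f x \<noteq> g x}"
  have "open ?S" using f g by (rule open_Collect_neq)
  moreover have "?S \<noteq> {}" using ne by auto
  moreover have "negligible ?S"
  proof -
    have "?S \<in> null_sets lborel"
      using ae \<open>open ?S\<close> by (subst AE_iff_null_sets) (auto simp: borel_open)
    then show ?thesis by (simp add: negligible_iff_null_sets null_sets_completionI)
  qed
  ultimately show False using open_not_negligible by blast
qed

lemma continuous_density_unique:
  fixes p q :: "real \<Rightarrow> real"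
  assumes p: "continuous_on UNIV p" "\<And>x. 0 \<le> p x" and q: "continuous_on UNIV q" "\<And>x. 0 \<le> q x"
    and eq: "density lborel p = density lborel q"
  shows "p = q"
proof (rule continuous_eq_if_AE_eq[OF p(1) q(1)])
  have [measurable]: "p \<in> borel_measurable borel" "q \<in> borel_measurable borel"
    using p q by (auto intro: borel_measurable_continuous_onI)
  have "AE x in lborel. ennreal (p x) = ennreal (q x)"
    using eq by (subst (asm) sigma_finite_measure.density_unique_iff[OF lborel.sigma_finite_measure_axioms]) auto
  then show "AE x in lborel. p x = q x"
    by eventually_elim (simp add: p q)
qed

lemma continuous_bounded_density_eq:
  fixes q :: "real \<Rightarrow> real"
  assumes Z: "Z \<in> borel_measurable M" and eq: "distr M borel Z = density lborel q"
    and q: "continuous_on UNIV q" "\<And>x. 0 \<le> q x" "\<And>x. q x \<le> B"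
  shows "continuous_bounded_density M Z = q"
  unfolding continuous_bounded_density_def
proof (rule the_equality)
  have d: "distr M lborel Z = distr M borel Z" by (rule distr_cong) auto
  have "bounded (range q)"
    using q(2,3) by (intro boundedI[of _ B]) auto
  moreover have "q \<in> borel_measurable borel" using q(1) by (rule borel_measurable_continuous_onI)
  ultimately show "distributed M lborel Z q \<and> (\<forall>x. 0 \<le> q x) \<and> continuous_on UNIV q \<and> bounded (range q)"
    using q Z by (auto simp: distributed_def d eq)
  fix p :: "real \<Rightarrow> real"
  assume p: "distributed M lborel Z p \<and> (\<forall>x. 0 \<le> p x) \<and> continuous_on UNIV p \<and> bounded (range p)"
  then have "density lborel p = density lborel q"
    by (auto simp: distributed_def d eq)
  then show "p = q" using p q by (intro continuous_density_unique) auto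
qed

section \<open>Elementary inequalities\<close>

lemma power_le_fact_exp:
  fixes x :: real
  assumes "0 \<le> x"
  shows "x ^ k \<le> fact k * exp x"
proof -
  obtain t where "exp x = (\<Sum>m<Suc k. x ^ m / fact m) + exp t / fact (Suc k) * x ^ Suc k"
    using Maclaurin_exp_le[of x "Suc k"] by blast
  then have "x ^ k / fact k \<le> exp x"
    using assms by (simp add: sum_nonneg)
  then show ?thesis by (simp add: field_simps)
qed

lemma abs_exp_minus_linear_le:
  fixes y :: real
  shows "\<bar>exp y - 1 - y\<bar> \<le> y\<^sup>2 * exp \<bar>y\<bar>"
proof -
  obtain t where t: "\<bar>t\<bar> \<le> \<bar>y\<bar>" "exp y = (\<Sum>m<2. y ^ m / fact m) + exp t / fact 2 * y\<^sup>2"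
    using Maclaurin_exp_le[of y 2] by blast
  then have "\<bar>exp y - 1 - y\<bar> = exp t / 2 * y\<^sup>2" by (simp add: numeral_2_eq_2)
  also have "\<dots> \<le> exp \<bar>y\<bar> * y\<^sup>2"
  proof (intro mult_right_mono)
    have "exp t \<le> exp \<bar>y\<bar>" using t(1) by simp
    then show "exp t / 2 \<le> exp \<bar>y\<bar>" using exp_gt_zero[of t] by linarith
  qed simp
  finally show ?thesis by (simp add: mult.commute)
qed

lemma cos_le_taylor4:
  fixes y :: real
  shows "cos y \<le> 1 - y\<^sup>2 / 2 + y ^ 4 / 24"
proof -
  obtain t where "cos y = (\<Sum>m<4. cos_coeff m * y ^ m) + cos (t + 1/2 * real 4 * pi) / fact 4 * y ^ 4"
    using Maclaurin_cos_expansion[of y 4] by blast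
  moreover have "(\<Sum>m<4. cos_coeff m * y ^ m) = 1 - y\<^sup>2 / 2"
  proof -
    have "{..<4} = {0, 1, 2, 3 :: nat}" by auto
    then show ?thesis by (simp add: cos_coeff_def)
  qed
  ultimately have "cos y = 1 - y\<^sup>2 / 2 + cos (t + 2 * pi) / 24 * y ^ 4"
    by (simp add: fact_numeral)
  moreover have "cos (t + 2 * pi) / 24 * y ^ 4 \<le> 1 / 24 * y ^ 4"
    by (intro mult_right_mono) auto
  ultimately show ?thesis by simp
qed

lemma exp_le_one_plus_self_times_exp: "exp y \<le> 1 + y * exp y" for y :: real
proof -
  have "(1 - y) * exp y \<le> exp (- y) * exp y"
    using exp_ge_add_one_self[of "- y"] by (intro mult_right_mono) auto
  then show ?thesis by (simp add: algebra_simps flip: exp_add)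
qed

text \<open>
  This turns the exponentially small tail into an \<open>O(1/n)\<close> error.  Write
  \<open>q ^ n = exp (- c * n)\<close> and use \<open>(c * n)\<^sup>2 \<le> 2 * exp (c * n)\<close>.
\<close>

lemma square_times_geometric_bounded:
  fixes q :: real
  assumes "0 < q" "q < 1"
  shows "(real n)\<^sup>2 * q ^ n \<le> 2 / (ln q)\<^sup>2"
proof -
  have c: "0 < - ln q" using assms by simp
  have "(- ln q * n) ^ 2 \<le> fact 2 * exp (- ln q * n)"
    using c by (intro power_le_fact_exp mult_nonneg_nonneg) auto
  moreover have "exp (- ln q * n) * q ^ n = 1"
  proof -
    have "q ^ n = exp (ln q * n)" using assms by (simp add: exp_of_nat2_mult)
    then show ?thesis by (simp flip: exp_add)
  qed
  ultimately have "(- ln q * n) ^ 2 * q ^ n \<le> 2"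
    using mult_right_mono[of "(- ln q * n) ^ 2" "2 * exp (- ln q * n)" "q ^ n"] assms by (simp add: mult.assoc)
  then show ?thesis using c by (simp add: power_mult_distrib field_simps)
qed

text \<open>
  For \<open>y \<le> 1/2\<close> this is \<open>(1 - y) * (1 + 2 * y) \<ge> 1\<close>; for larger \<open>y\<close> the bound \<open>v \<ge> 1/2\<close>
  takes over.
\<close>

lemma inverse_sqrt_le_exp:
  fixes v y :: real
  assumes "1 / 2 \<le> v" "1 - y \<le> v" "0 \<le> y"
  shows "1 / sqrt v \<le> exp y"
proof -
  have "1 \<le> v * exp (2 * y)"
  proof (cases "y \<le> 1 / 2")
    case True
    have "1 \<le> (1 - y) * (1 + 2 * y)" using True assms(3) by (simp add: algebra_simps mult_left_le)
    also have "\<dots> \<le> v * exp (2 * y)" using True assms by (intro mult_mono) auto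
    finally show ?thesis .
  next
    case False
    have "1 \<le> 1 / 2 * (1 + 2 * y)" using False by simp
    also have "\<dots> \<le> v * exp (2 * y)" using assms by (intro mult_mono) auto
    finally show ?thesis .
  qed
  also have "\<dots> = (sqrt v * exp y)\<^sup>2" using assms by (simp add: power_mult_distrib exp_double)
  finally have "1 \<le> sqrt v * exp y"
    using assms power2_le_imp_le[of 1 "sqrt v * exp y"] by simp
  then show ?thesis using assms by (simp add: field_simps)
qed

text \<open>
  With \<open>w = h ^ (m - 2)\<close> the exponent is \<open>w * (C - a * n * h\<^sup>2)\<close>.  It is positive only if
  \<open>h\<^sup>2 < C / (a * n)\<close>, and then \<open>w \<le> h\<^sup>2\<close> is itself of order \<open>1/n\<close>.  This is where \<open>m \<ge> 4\<close>
  enters.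
\<close>

lemma exponent_tradeoff:
  fixes a C h :: real and n m :: nat
  assumes a: "0 < a" and C: "0 \<le> C" and n: "1 \<le> n" and m: "4 \<le> m" "even m" and h: "\<bar>h\<bar> \<le> 1"
  shows "exp (C * h ^ (m - 2) - a * n * h ^ m) \<le> 1 + C\<^sup>2 / a * exp (C\<^sup>2 / a) / n"
proof -
  define w where "w = h ^ (m - 2)"
  have em: "even (m - 2)" using m by simp
  then have w0: "0 \<le> w" unfolding w_def by (rule zero_le_even_power)
  have m2: "m = (m - 2) + 2" using m by simp
  have hm: "h ^ m = w * h\<^sup>2" unfolding w_def power_add[symmetric] using m2 by simp
  have w1: "w \<le> h\<^sup>2"
  proof -
    have "\<bar>h\<bar> ^ (m - 2) \<le> \<bar>h\<bar>\<^sup>2" using h m by (intro power_decreasing) auto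
    then show ?thesis using em by (simp add: w_def power_even_abs)
  qed
  define z where "z = C\<^sup>2 / (a * n)"
  have z: "0 \<le> z" "z \<le> C\<^sup>2 / a" using a n by (auto simp: z_def intro!: divide_left_mono)
  have "C * w - a * n * h ^ m \<le> z"
  proof (cases "C \<le> a * n * h\<^sup>2")
    case True
    then have "w * C \<le> w * (a * n * h\<^sup>2)" using w0 by (intro mult_left_mono)
    then show ?thesis using z by (simp add: hm mult_ac)
  next
    case False
    then have "h\<^sup>2 \<le> C / (a * n)" using a n by (simp add: field_simps)
    with w1 have "w * C \<le> C / (a * n) * C" using C by (intro mult_right_mono) auto
    moreover have "0 \<le> a * n * h ^ m" using a w0 by (simp add: hm)
    ultimately show ?thesis by (simp add: z_def power2_eq_square mult.commute)
  qed
  then have "exp (C * w - a * n * h ^ m) \<le> exp z" by simp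
  also have "\<dots> \<le> 1 + z * exp z" by (rule exp_le_one_plus_self_times_exp)
  also have "\<dots> \<le> 1 + z * exp (C\<^sup>2 / a)" using z by (intro add_left_mono mult_left_mono) auto
  also have "\<dots> = 1 + C\<^sup>2 / a * exp (C\<^sup>2 / a) / n" by (simp add: z_def)
  finally show ?thesis by (simp add: w_def)
qed

lemma gaussian_integral:
  fixes v :: real
  assumes "0 < v"
  shows "has_bochner_integral lborel (\<lambda>s. exp (- (v * s\<^sup>2 / 2))) (sqrt (2 * pi / v))"
proof -
  have sq: "sqrt (2 * pi * (1 / sqrt v)\<^sup>2) = sqrt (2 * pi / v)"
    using assms by (simp add: power_divide)
  have "exp (- (v * s\<^sup>2 / 2)) = sqrt (2 * pi / v) * normal_density 0 (1 / sqrt v) s" for s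
    using assms by (simp add: normal_density_def sq power_divide mult.commute)
  moreover have "has_bochner_integral lborel (\<lambda>s. sqrt (2 * pi / v) * normal_density 0 (1 / sqrt v) s) (sqrt (2 * pi / v) * 1)"
    using assms integral_normal_density[of "1 / sqrt v" 0] integrable_normal_density[of "1 / sqrt v" 0]
    by (intro has_bochner_integral_mult_right) (simp add: has_bochner_integral_iff)
  ultimately show ?thesis by simp
qed

text \<open>
  The bound for the central part of the integral after rescaling by \<open>sqrt n\<close>.  The quartic term becomes
  \<open>y = D * s ^ 4 / (2 * n)\<close>; replacing \<open>exp y\<close> by \<open>1 + y * exp y\<close> makes its contribution
  of order \<open>1/n\<close>, and the smallness condition leaves enough of the Gaussian to absorb \<open>exp y\<close> and \<open>s ^ 4\<close>.
\<close>

lemma gaussian_quartic_exp_power_le: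
  fixes D v s :: real and n :: nat
  assumes n: "1 \<le> n" and D: "0 \<le> D" and v: "1 / 2 \<le> v" and small: "D * (s / sqrt n)\<^sup>2 \<le> 1 / 8"
  shows "exp ((- ((s / sqrt n)\<^sup>2 * v) + D * (s / sqrt n) ^ 4) / 2) ^ n
    \<le> exp (- (v * s\<^sup>2 / 2)) + 256 * D / n * exp (- (1 / 4 * s\<^sup>2 / 2))"
proof -
  have n0: "0 < real n" using n by simp
  have sq: "(s / sqrt n)\<^sup>2 = s\<^sup>2 / n" using n0 by (simp add: power_divide)
  have qu: "(s / sqrt n) ^ 4 = s ^ 4 / (real n)\<^sup>2"
  proof -
    have "(s / sqrt n) ^ 4 = ((s / sqrt n)\<^sup>2)\<^sup>2" by simp
    also have "\<dots> = s ^ 4 / (real n)\<^sup>2" unfolding sq by (simp add: power_divide)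
    finally show ?thesis .
  qed
  define y where "y = D * s ^ 4 / (2 * n)"
  have y0: "0 \<le> y" using D by (simp add: y_def)
  have y_le: "y \<le> s\<^sup>2 / 16"
  proof -
    have "y = D * (s\<^sup>2 / n) * s\<^sup>2 / 2" by (simp add: y_def power2_eq_square power4_eq_xxxx)
    also have "\<dots> \<le> 1 / 8 * s\<^sup>2 / 2" using small unfolding sq by (intro divide_right_mono mult_right_mono) auto
    finally show ?thesis by simp
  qed
  have "exp ((- ((s / sqrt n)\<^sup>2 * v) + D * (s / sqrt n) ^ 4) / 2) ^ n
     = exp (n * ((- ((s / sqrt n)\<^sup>2 * v) + D * (s / sqrt n) ^ 4) / 2))" by (rule exp_of_nat_mult[symmetric])
  also have "n * ((- ((s / sqrt n)\<^sup>2 * v) + D * (s / sqrt n) ^ 4) / 2) = - (v * s\<^sup>2 / 2) + y"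
    unfolding sq qu y_def using n0 by (simp add: field_simps power2_eq_square)
  also have "exp \<dots> = exp (- (v * s\<^sup>2 / 2)) * exp y" by (rule exp_add)
  also have "\<dots> \<le> exp (- (v * s\<^sup>2 / 2)) * (1 + y * exp y)" by (intro mult_left_mono exp_le_one_plus_self_times_exp) simp
  also have "\<dots> = exp (- (v * s\<^sup>2 / 2)) + y * exp (- (v * s\<^sup>2 / 2) + y)" 
    unfolding exp_add by (simp add: distrib_left)
  also have "\<dots> \<le> exp (- (v * s\<^sup>2 / 2)) + 256 * D / n * exp (- (1 / 4 * s\<^sup>2 / 2))"
  proof (rule add_left_mono)
    have "1 / 2 * s\<^sup>2 \<le> v * s\<^sup>2" using v by (intro mult_right_mono) auto
    then have "- (v * s\<^sup>2 / 2) + y \<le> - 3 * (s\<^sup>2 / 16)" using y_le by linarith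
    then have "y * exp (- (v * s\<^sup>2 / 2) + y) \<le> y * exp (- 3 * (s\<^sup>2 / 16))"
      using y0 by (intro mult_left_mono) auto
    also have "s ^ 4 \<le> 512 * exp (s\<^sup>2 / 16)"
      using power_le_fact_exp[of "s\<^sup>2 / 16" 2] by (simp add: power_divide)
    then have "D * s ^ 4 / (2 * n) * exp (- 3 * (s\<^sup>2 / 16)) \<le> D * (512 * exp (s\<^sup>2 / 16)) / (2 * n) * exp (- 3 * (s\<^sup>2 / 16))"
      using D by (intro mult_right_mono divide_right_mono mult_left_mono) auto
    then have "y * exp (- 3 * (s\<^sup>2 / 16)) \<le> 256 * D / n * (exp (s\<^sup>2 / 16) * exp (- 3 * (s\<^sup>2 / 16)))"
      by (simp add: y_def)
    also have "exp (s\<^sup>2 / 16) * exp (- 3 * (s\<^sup>2 / 16)) = exp (- (1 / 4 * s\<^sup>2 / 2))"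
      by (simp flip: exp_add)
    finally show "y * exp (- (v * s\<^sup>2 / 2) + y) \<le> 256 * D / n * exp (- (1 / 4 * s\<^sup>2 / 2))" .
  qed
  finally show ?thesis .
qed

lemma has_bochner_integral_mono:
  fixes f g :: "'a \<Rightarrow> real"
  assumes "has_bochner_integral M f x" "has_bochner_integral M g y" "\<And>\<omega>. f \<omega> \<le> g \<omega>"
  shows "x \<le> y"
  using assms integral_mono[of M f g] by (auto simp: has_bochner_integral_iff)

section \<open>Exponential moments and the cumulant generating function\<close>

locale exponential_moments = prob_space M for M :: "'a measure" +
  fixes X :: "'a \<Rightarrow> real" and b :: real
  assumes X_measurable [measurable]: "X \<in> borel_measurable M"
    and b_pos: "0 < b"
    and integrable_exp_abs: "integrable M (\<lambda>\<omega>. exp (b * \<bar>X \<omega>\<bar>))"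
begin

definition exp_moment :: "nat \<Rightarrow> real \<Rightarrow> real" where
  "exp_moment k h = (\<integral>\<omega>. X \<omega> ^ k * exp (h * X \<omega>) \<partial>M)"

lemma integrable_power_exp_abs:
  assumes "h < b"
  shows "integrable M (\<lambda>\<omega>. \<bar>X \<omega>\<bar> ^ k * exp (h * \<bar>X \<omega>\<bar>))"
proof (rule Bochner_Integration.integrable_bound)
  show "integrable M (\<lambda>\<omega>. fact k / (b - h) ^ k * exp (b * \<bar>X \<omega>\<bar>))"
    by (intro integrable_mult_right integrable_exp_abs)
  show "AE \<omega> in M. norm (\<bar>X \<omega>\<bar> ^ k * exp (h * \<bar>X \<omega>\<bar>)) \<le> norm (fact k / (b - h) ^ k * exp (b * \<bar>X \<omega>\<bar>))"
  proof (rule AE_I2)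
    fix \<omega>
    have "((b - h) * \<bar>X \<omega>\<bar>) ^ k * exp (h * \<bar>X \<omega>\<bar>) \<le> fact k * exp ((b - h) * \<bar>X \<omega>\<bar>) * exp (h * \<bar>X \<omega>\<bar>)"
      using assms by (intro mult_right_mono power_le_fact_exp) auto
    also have "\<dots> = fact k * exp (b * \<bar>X \<omega>\<bar>)"
      by (simp add: algebra_simps flip: exp_add)
    finally show "norm (\<bar>X \<omega>\<bar> ^ k * exp (h * \<bar>X \<omega>\<bar>)) \<le> norm (fact k / (b - h) ^ k * exp (b * \<bar>X \<omega>\<bar>))"
      using assms by (simp add: power_mult_distrib pos_le_divide_eq mult_ac)
  qed
qed measurable

lemma integrable_power_exp:
  assumes "\<bar>h\<bar> < b"
  shows "integrable M (\<lambda>\<omega>. X \<omega> ^ k * exp (h * X \<omega>))"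
proof (rule Bochner_Integration.integrable_bound[OF integrable_power_exp_abs[OF assms, of k]])
  show "AE \<omega> in M. norm (X \<omega> ^ k * exp (h * X \<omega>)) \<le> norm (\<bar>X \<omega>\<bar> ^ k * exp (\<bar>h\<bar> * \<bar>X \<omega>\<bar>))"
  proof (rule AE_I2)
    fix \<omega>
    have "exp (h * X \<omega>) \<le> exp (\<bar>h\<bar> * \<bar>X \<omega>\<bar>)" by (simp flip: abs_mult)
    then show "norm (X \<omega> ^ k * exp (h * X \<omega>)) \<le> norm (\<bar>X \<omega>\<bar> ^ k * exp (\<bar>h\<bar> * \<bar>X \<omega>\<bar>))"
      by (simp add: abs_mult power_abs mult_left_mono)
  qed
qed measurable

lemma integrable_exp:
  assumes "\<bar>h\<bar> < b"
  shows "integrable M (\<lambda>\<omega>. exp (h * X \<omega>))"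
  using integrable_power_exp[OF assms, of 0] by simp

text \<open>
  The second order remainder of the exponential is dominated by an exponential moment of slightly larger
  order, which is finite because \<open>|h|\<close> is strictly below \<open>b\<close>.
\<close>

lemma exp_moment_has_derivative:
  assumes h: "\<bar>h\<bar> < b"
  shows "(exp_moment k has_real_derivative exp_moment (Suc k) h) (at h)"
proof -
  \<comment> \<open>half the distance to the boundary, so that all points in reach have finite exponential moments\<close>
  define r where "r = (b - \<bar>h\<bar>) / 2"
  define C where "C = (\<integral>\<omega>. \<bar>X \<omega>\<bar> ^ (k + 2) * exp ((\<bar>h\<bar> + r) * \<bar>X \<omega>\<bar>) \<partial>M)"
  have r: "0 < r" "\<bar>h\<bar> + r < b" using h by (auto simp: r_def field_simps)
  have bound: "\<bar>exp_moment k (h + s) - exp_moment k h - s * exp_moment (Suc k) h\<bar> \<le> s\<^sup>2 * C"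
    if s: "\<bar>s\<bar> \<le> r" for s
  proof -
    have hs: "\<bar>h + s\<bar> < b" using s r by linarith
    have ptw: "\<bar>X \<omega> ^ k * exp ((h + s) * X \<omega>) - X \<omega> ^ k * exp (h * X \<omega>) - s * (X \<omega> ^ Suc k * exp (h * X \<omega>))\<bar>
        \<le> s\<^sup>2 * (\<bar>X \<omega>\<bar> ^ (k + 2) * exp ((\<bar>h\<bar> + r) * \<bar>X \<omega>\<bar>))" for \<omega>
    proof -
      let ?x = "X \<omega>"
      have "\<bar>?x ^ k * exp ((h + s) * ?x) - ?x ^ k * exp (h * ?x) - s * (?x ^ Suc k * exp (h * ?x))\<bar>
          = \<bar>?x\<bar> ^ k * exp (h * ?x) * \<bar>exp (s * ?x) - 1 - s * ?x\<bar>"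
      proof -
        have "?x ^ k * exp ((h + s) * ?x) - ?x ^ k * exp (h * ?x) - s * (?x ^ Suc k * exp (h * ?x))
            = ?x ^ k * exp (h * ?x) * (exp (s * ?x) - 1 - s * ?x)"
          by (simp add: algebra_simps exp_add)
        then show ?thesis by (simp add: abs_mult power_abs)
      qed
      also have "\<dots> \<le> \<bar>?x\<bar> ^ k * exp (\<bar>h\<bar> * \<bar>?x\<bar>) * ((s * ?x)\<^sup>2 * exp (r * \<bar>?x\<bar>))"
      proof (intro mult_mono)
        show "exp (h * ?x) \<le> exp (\<bar>h\<bar> * \<bar>?x\<bar>)" by (simp flip: abs_mult)
        have "exp \<bar>s * ?x\<bar> \<le> exp (r * \<bar>?x\<bar>)" using s by (simp add: abs_mult mult_right_mono)
        then have "(s * ?x)\<^sup>2 * exp \<bar>s * ?x\<bar> \<le> (s * ?x)\<^sup>2 * exp (r * \<bar>?x\<bar>)" by (intro mult_left_mono) auto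
        then show "\<bar>exp (s * ?x) - 1 - s * ?x\<bar> \<le> (s * ?x)\<^sup>2 * exp (r * \<bar>?x\<bar>)"
          using abs_exp_minus_linear_le[of "s * ?x"] by linarith
      qed auto
      also have "\<dots> = s\<^sup>2 * (\<bar>?x\<bar> ^ (k + 2) * exp ((\<bar>h\<bar> + r) * \<bar>?x\<bar>))"
      proof -
        have 1: "(s * ?x)\<^sup>2 = s\<^sup>2 * \<bar>?x\<bar>\<^sup>2" by (simp add: power_mult_distrib)
        have 2: "exp ((\<bar>h\<bar> + r) * \<bar>?x\<bar>) = exp (\<bar>h\<bar> * \<bar>?x\<bar>) * exp (r * \<bar>?x\<bar>)"
          by (simp add: distrib_right exp_add)
        have 3: "\<bar>?x\<bar> ^ (k + 2) = \<bar>?x\<bar> ^ k * \<bar>?x\<bar>\<^sup>2" by (rule power_add)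
        have "A * E * (S * N * F) = S * (A * N * (E * F))" for A E S N F :: real by simp
        then show ?thesis unfolding 1 2 3 .
      qed
      finally show ?thesis .
    qed
    have lin: "(\<integral>\<omega>. f \<omega> - g \<omega> - s * e \<omega> \<partial>M) = (\<integral>\<omega>. f \<omega> \<partial>M) - (\<integral>\<omega>. g \<omega> \<partial>M) - s * (\<integral>\<omega>. e \<omega> \<partial>M)"
      if "integrable M f" "integrable M g" "integrable M e" for f g e :: "'a \<Rightarrow> real"
      using that by simp
    have eq: "exp_moment k (h + s) - exp_moment k h - s * exp_moment (Suc k) h
       = (\<integral>\<omega>. X \<omega> ^ k * exp ((h + s) * X \<omega>) - X \<omega> ^ k * exp (h * X \<omega>) - s * (X \<omega> ^ Suc k * exp (h * X \<omega>)) \<partial>M)"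
      unfolding exp_moment_def
      by (rule lin[symmetric]; rule integrable_power_exp[OF h] integrable_power_exp[OF hs])
    have "\<bar>exp_moment k (h + s) - exp_moment k h - s * exp_moment (Suc k) h\<bar>
        \<le> (\<integral>\<omega>. s\<^sup>2 * (\<bar>X \<omega>\<bar> ^ (k + 2) * exp ((\<bar>h\<bar> + r) * \<bar>X \<omega>\<bar>)) \<partial>M)"
      unfolding eq
    proof (rule order_trans[OF integral_abs_bound integral_mono])
      show "integrable M (\<lambda>\<omega>. \<bar>X \<omega> ^ k * exp ((h + s) * X \<omega>) - X \<omega> ^ k * exp (h * X \<omega>)
          - s * (X \<omega> ^ Suc k * exp (h * X \<omega>))\<bar>)"
        by (intro integrable_abs Bochner_Integration.integrable_diff integrable_mult_right
            integrable_power_exp[OF h] integrable_power_exp[OF hs])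
      show "integrable M (\<lambda>\<omega>. s\<^sup>2 * (\<bar>X \<omega>\<bar> ^ (k + 2) * exp ((\<bar>h\<bar> + r) * \<bar>X \<omega>\<bar>)))"
        by (intro integrable_mult_right integrable_power_exp_abs r)
    qed (rule ptw)
    also have "\<dots> = s\<^sup>2 * C"
      unfolding C_def by (rule integral_mult_right_zero)
    finally show ?thesis .
  qed
  show ?thesis
    unfolding DERIV_def
  proof (rule LIM_zero_cancel, rule Lim_null_comparison)
    have "((\<lambda>s. \<bar>s\<bar> * C) \<longlongrightarrow> \<bar>0\<bar> * C) (at 0)" by (intro tendsto_intros)
    then show "((\<lambda>s. \<bar>s\<bar> * C) \<longlongrightarrow> 0) (at 0)" by simp
    show "\<forall>\<^sub>F s in at 0. norm ((exp_moment k (h + s) - exp_moment k h) / s - exp_moment (Suc k) h) \<le> \<bar>s\<bar> * C"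
      unfolding eventually_at
    proof (intro exI[of _ r] conjI ballI impI r)
      fix s :: real assume s: "s \<noteq> 0 \<and> dist s 0 < r"
      have "(exp_moment k (h + s) - exp_moment k h) / s - exp_moment (Suc k) h
          = (exp_moment k (h + s) - exp_moment k h - s * exp_moment (Suc k) h) / s"
        using s by (simp add: field_simps)
      also have "\<bar>\<dots>\<bar> \<le> s\<^sup>2 * C / \<bar>s\<bar>"
        using bound[of s] s by (simp add: abs_divide divide_right_mono)
      also have "\<dots> = \<bar>s\<bar> * C"
        using s by (simp add: power2_eq_square field_simps abs_if)
      finally show "norm ((exp_moment k (h + s) - exp_moment k h) / s - exp_moment (Suc k) h) \<le> \<bar>s\<bar> * C" by simp
    qed
  qed
qed

lemma exp_moment_isCont: "\<bar>h\<bar> < b \<Longrightarrow> isCont (exp_moment k) h"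
  using exp_moment_has_derivative by (rule DERIV_isCont)

lemma exp_moment_0_pos:
  assumes "\<bar>h\<bar> < b"
  shows "0 < exp_moment 0 h"
proof -
  have int: "integrable M (\<lambda>\<omega>. exp (h * X \<omega>))" by (rule integrable_exp[OF assms])
  have "0 \<le> exp_moment 0 h" unfolding exp_moment_def by simp
  moreover have "exp_moment 0 h \<noteq> 0"
    using integral_nonneg_eq_0_iff_AE[OF int] prob_space_axioms
    by (simp add: exp_moment_def AE_False)
  ultimately show ?thesis by simp
qed

lemma exp_moment_0_0: "exp_moment 0 0 = 1"
  by (simp add: exp_moment_def prob_space)

text \<open>
  The closure of the moments and of \<open>1 / exp_moment 0\<close> under the ring operations.  It is stable under
  differentiation and contains \<open>K'\<close>, which gives derivatives of \<open>K\<close> of all orders without formulas for them.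
\<close>

inductive smooth_expr :: "(real \<Rightarrow> real) \<Rightarrow> bool" where
  moment: "smooth_expr (exp_moment k)"
| inv: "smooth_expr (\<lambda>h. inverse (exp_moment 0 h))"
| uminus: "smooth_expr f \<Longrightarrow> smooth_expr (\<lambda>h. - f h)"
| add: "smooth_expr f \<Longrightarrow> smooth_expr g \<Longrightarrow> smooth_expr (\<lambda>h. f h + g h)"
| mult: "smooth_expr f \<Longrightarrow> smooth_expr g \<Longrightarrow> smooth_expr (\<lambda>h. f h * g h)"

lemma smooth_expr_derivative:
  assumes "smooth_expr f"
  shows "\<exists>g. smooth_expr g \<and> (\<forall>h. \<bar>h\<bar> < b \<longrightarrow> (f has_real_derivative g h) (at h))"
  using assms
proof induction
  case (moment k)
  show ?case using smooth_expr.moment exp_moment_has_derivative by blast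
next
  case inv
  let ?i = "\<lambda>h. inverse (exp_moment 0 h)"
  have "smooth_expr (\<lambda>h. - (?i h * exp_moment 1 h * ?i h))"
    by (intro smooth_expr.intros)
  moreover have "(?i has_real_derivative - (?i h * exp_moment 1 h * ?i h)) (at h)" if "\<bar>h\<bar> < b" for h
    using exp_moment_has_derivative[OF that, of 0] exp_moment_0_pos[OF that]
    by (intro DERIV_inverse') auto
  ultimately show ?case by blast
next
  case (uminus f)
  then obtain f' where "smooth_expr f'" "\<forall>h. \<bar>h\<bar> < b \<longrightarrow> (f has_real_derivative f' h) (at h)" by blast
  then show ?case
    by (intro exI[of _ "\<lambda>h. - f' h"]) (auto intro: smooth_expr.uminus intro!: derivative_intros)
next
  case (add f g)
  then obtain f' g' where "smooth_expr f'" "\<forall>h. \<bar>h\<bar> < b \<longrightarrow> (f has_real_derivative f' h) (at h)"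
    "smooth_expr g'" "\<forall>h. \<bar>h\<bar> < b \<longrightarrow> (g has_real_derivative g' h) (at h)" by blast
  then show ?case
    by (intro exI[of _ "\<lambda>h. f' h + g' h"]) (auto intro: smooth_expr.add intro!: derivative_intros)
next
  case (mult f g)
  then obtain f' g' where *: "smooth_expr f'" "\<forall>h. \<bar>h\<bar> < b \<longrightarrow> (f has_real_derivative f' h) (at h)"
    "smooth_expr g'" "\<forall>h. \<bar>h\<bar> < b \<longrightarrow> (g has_real_derivative g' h) (at h)" by blast
  have "smooth_expr (\<lambda>h. f h * g' h + f' h * g h)"
    by (intro smooth_expr.add smooth_expr.mult mult.hyps *)
  then show ?case using * by (intro exI[of _ "\<lambda>h. f h * g' h + f' h * g h"]) (auto intro: DERIV_mult')
qed

abbreviation cgf_deriv :: "nat \<Rightarrow> real \<Rightarrow> real" where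
  "cgf_deriv k \<equiv> (deriv ^^ k) (cumulant_gen M X)"

lemma cumulant_gen_eq: "cumulant_gen M X h = ln (exp_moment 0 h)"
  by (simp add: cumulant_gen_def exp_moment_def)

lemma cumulant_gen_has_derivative:
  assumes "\<bar>h\<bar> < b"
  shows "(cumulant_gen M X has_real_derivative exp_moment 1 h / exp_moment 0 h) (at h)"
  unfolding cumulant_gen_eq[abs_def]
  using exp_moment_has_derivative[OF assms, of 0] exp_moment_0_pos[OF assms]
  by (auto intro!: derivative_eq_intros)

lemma has_derivative_transform_on_ball:
  assumes "(g has_real_derivative D) (at h)" and "\<bar>h\<bar> < b" and "\<And>z. \<bar>z\<bar> < b \<Longrightarrow> f z = g z"
  shows "(f has_real_derivative D) (at h)"
  using assms(1) by (rule has_field_derivative_transform_within_open[where S="{-b<..<b}"])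
    (use assms in \<open>auto simp: abs_less_iff\<close>)

lemma cgf_deriv_Suc_smooth:
  "\<exists>g. smooth_expr g \<and> (\<forall>h. \<bar>h\<bar> < b \<longrightarrow> cgf_deriv (Suc k) h = g h)"
proof (induction k)
  case 0
  have "smooth_expr (\<lambda>h. exp_moment 1 h * inverse (exp_moment 0 h))"
    by (intro smooth_expr.intros)
  then show ?case
    using DERIV_imp_deriv[OF cumulant_gen_has_derivative]
    by (intro exI[of _ "\<lambda>h. exp_moment 1 h * inverse (exp_moment 0 h)"]) (simp add: divide_inverse)
next
  case (Suc k)
  then obtain g where g: "smooth_expr g" "\<And>h. \<bar>h\<bar> < b \<Longrightarrow> cgf_deriv (Suc k) h = g h" by blast
  obtain g' where g': "smooth_expr g'" "\<And>h. \<bar>h\<bar> < b \<Longrightarrow> (g has_real_derivative g' h) (at h)"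
    using smooth_expr_derivative[OF g(1)] by blast
  have "cgf_deriv (Suc (Suc k)) h = g' h" if "\<bar>h\<bar> < b" for h
    using DERIV_imp_deriv[OF has_derivative_transform_on_ball[OF g'(2)[OF that] that g(2)]] by simp
  with g'(1) show ?case by blast
qed

lemma cgf_deriv_has_derivative:
  assumes h: "\<bar>h\<bar> < b"
  shows "(cgf_deriv k has_real_derivative cgf_deriv (Suc k) h) (at h)"
proof -
  have "\<exists>D. (cgf_deriv k has_real_derivative D) (at h)"
  proof (cases k)
    case 0
    then show ?thesis using cumulant_gen_has_derivative[OF h] by auto
  next
    case (Suc j)
    obtain g where g: "smooth_expr g" "\<And>h. \<bar>h\<bar> < b \<Longrightarrow> cgf_deriv k h = g h"
      using cgf_deriv_Suc_smooth[of j] Suc by blast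
    obtain g' where "(g has_real_derivative g' h) (at h)"
      using smooth_expr_derivative[OF g(1)] h by blast
    from has_derivative_transform_on_ball[OF this h g(2)] show ?thesis by blast
  qed
  then show ?thesis using DERIV_imp_deriv by force
qed

lemma cgf_deriv_2:
  assumes h: "\<bar>h\<bar> < b"
  shows "cgf_deriv 2 h = (exp_moment 2 h * exp_moment 0 h - (exp_moment 1 h)\<^sup>2) / (exp_moment 0 h)\<^sup>2"
proof -
  have 1: "cgf_deriv 1 h = exp_moment 1 h / exp_moment 0 h" if "\<bar>h\<bar> < b" for h
    using DERIV_imp_deriv[OF cumulant_gen_has_derivative[OF that]] by simp
  have "((\<lambda>h. exp_moment 1 h / exp_moment 0 h) has_real_derivative
      (exp_moment 2 h * exp_moment 0 h - exp_moment 1 h * exp_moment 1 h) / (exp_moment 0 h * exp_moment 0 h)) (at h)"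
    using exp_moment_has_derivative[OF h, of 0] exp_moment_has_derivative[OF h, of 1] exp_moment_0_pos[OF h]
    by (intro DERIV_divide) (auto simp: numeral_2_eq_2)
  then have "(cgf_deriv 1 has_real_derivative
      (exp_moment 2 h * exp_moment 0 h - exp_moment 1 h * exp_moment 1 h) / (exp_moment 0 h * exp_moment 0 h)) (at h)"
    by (rule has_derivative_transform_on_ball[OF _ h 1])
  from DERIV_imp_deriv[OF this] show ?thesis by (simp add: numeral_2_eq_2)
qed

lemma cgf_deriv_isCont: "\<bar>h\<bar> < b \<Longrightarrow> isCont (cgf_deriv k) h"
  using cgf_deriv_has_derivative by (rule DERIV_isCont)

text \<open>
  Taylor's formula at order \<open>m\<close> for \<open>K\<close>, and at order \<open>m - 2\<close> for \<open>K''\<close>.  Apart from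
  \<open>h\<^sup>2 / 2\<close> and the constant \<open>1\<close>, respectively, all terms before the remainder vanish, and the \<open>m\<close>-th derivative in the remainder lies between
  \<open>3/2\<close> and \<open>1/2\<close> times \<open>\<gamma>_m\<close> near \<open>0\<close>.  As \<open>m\<close> is even, the powers of \<open>h\<close> are nonnegative.
\<close>

lemma cgf_expansion:
  assumes mean: "expectation X = 0" and var: "variance X = 1"
    and m: "4 \<le> m" "even m"
    and zero: "\<And>k. 3 \<le> k \<Longrightarrow> k < m \<Longrightarrow> cumulant M X k = 0"
    and neg: "cumulant M X m < 0"
  obtains \<rho> a C :: real where "0 < \<rho>" "\<rho> < b" "\<rho> \<le> 1" "0 < a" "0 \<le> C"
    "\<And>h. \<bar>h\<bar> \<le> \<rho> \<Longrightarrow> cumulant_gen M X h \<le> h\<^sup>2 / 2 - a * h ^ m"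
    "\<And>h. \<bar>h\<bar> \<le> \<rho> \<Longrightarrow> 1 - C * h ^ (m - 2) \<le> cgf_deriv 2 h"
proof -
  define \<gamma> where "\<gamma> = cumulant M X m"
  have b0: "\<bar>0\<bar> < b" using b_pos by simp
  have m0: "exp_moment 0 0 = 1" by (rule exp_moment_0_0)
  have m1: "exp_moment 1 0 = 0" using mean by (simp add: exp_moment_def)
  have m2: "exp_moment 2 0 = 1" using var mean by (simp add: exp_moment_def)
  have d0: "cgf_deriv 0 0 = 0" by (simp add: cumulant_gen_eq m0)
  have d1: "cgf_deriv 1 0 = 0"
  proof -
    have "deriv (cumulant_gen M X) 0 = exp_moment 1 0 / exp_moment 0 0"
      by (rule DERIV_imp_deriv[OF cumulant_gen_has_derivative[OF b0]])
    then show ?thesis unfolding m1 by simp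
  qed
  have d2: "cgf_deriv 2 0 = 1" unfolding cgf_deriv_2[OF b0] m0 m1 m2 by simp
  have dk: "cgf_deriv k 0 = 0" if "3 \<le> k" "k < m" for k
    using zero[OF that] by (simp add: cumulant_def)
  have \<gamma>: "cgf_deriv m 0 = \<gamma>" "\<gamma> < 0" using neg by (auto simp: cumulant_def \<gamma>_def)
  have "\<exists>d>0. \<forall>h. dist h 0 < d \<longrightarrow> dist (cgf_deriv m h) (cgf_deriv m 0) < - \<gamma> / 2"
    using cgf_deriv_isCont[OF b0, of m] \<gamma> unfolding continuous_at_eps_delta
    by (auto dest!: spec[of _ "- \<gamma> / 2"])
  then obtain d where d: "0 < d" "\<And>h. \<bar>h\<bar> < d \<Longrightarrow> \<bar>cgf_deriv m h - \<gamma>\<bar> < - \<gamma> / 2"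
    by (auto simp: dist_real_def \<gamma>)
  define \<rho> where "\<rho> = min 1 (min (d / 2) (b / 2))"
  have \<rho>: "0 < \<rho>" "\<rho> < b" "\<rho> < d" "\<rho> \<le> 1" using d b_pos by (auto simp: \<rho>_def)
  have near: "3 / 2 * \<gamma> \<le> cgf_deriv m h" "cgf_deriv m h \<le> \<gamma> / 2" if "\<bar>h\<bar> \<le> \<rho>" for h
  proof -
    have "\<bar>cgf_deriv m h - \<gamma>\<bar> < - \<gamma> / 2" using that \<rho> by (intro d(2)) linarith
    then show "3 / 2 * \<gamma> \<le> cgf_deriv m h" "cgf_deriv m h \<le> \<gamma> / 2"
      unfolding abs_less_iff by linarith+
  qed
  show thesis
  proof (rule that[of \<rho> "- \<gamma> / (2 * fact m)" "- 3 / 2 * \<gamma> / fact (m - 2)"])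
    show "0 < \<rho>" "\<rho> < b" "\<rho> \<le> 1" by fact+
    show "0 < - \<gamma> / (2 * fact m)" using \<gamma> by (simp add: field_simps)
    show "0 \<le> - 3 / 2 * \<gamma> / fact (m - 2)" using \<gamma> by (simp add: field_simps)
  next
    fix h :: real assume h: "\<bar>h\<bar> \<le> \<rho>"
    obtain t where t: "\<bar>t\<bar> \<le> \<bar>h\<bar>"
      "cumulant_gen M X h = (\<Sum>k<m. cgf_deriv k 0 / fact k * h ^ k) + cgf_deriv m t / fact m * h ^ m"
      using Maclaurin_bi_le[of cgf_deriv "cumulant_gen M X" m h] cgf_deriv_has_derivative h \<rho> by force
    have "(\<Sum>k<m. cgf_deriv k 0 / fact k * h ^ k) = (\<Sum>k\<in>{2}. cgf_deriv k 0 / fact k * h ^ k)"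
    proof (rule sum.mono_neutral_right)
      show "\<forall>i\<in>{..<m} - {2}. cgf_deriv i 0 / fact i * h ^ i = 0"
      proof
        fix i assume i: "i \<in> {..<m} - {2}"
        then consider "i = 0" | "i = 1" | "3 \<le> i" "i < m" by force
        then have "cgf_deriv i 0 = 0" by cases (use d0 d1 dk in auto)
        then show "cgf_deriv i 0 / fact i * h ^ i = 0" by simp
      qed
    qed (use m in auto)
    also have "\<dots> = h\<^sup>2 / 2" using d2 by simp
    finally have K: "cumulant_gen M X h = h\<^sup>2 / 2 + cgf_deriv m t / fact m * h ^ m" using t by simp
    have "cgf_deriv m t / fact m * h ^ m \<le> (\<gamma> / 2) / fact m * h ^ m"
      using near(2)[of t] t(1) h m by (intro mult_right_mono divide_right_mono zero_le_even_power) auto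
    then show "cumulant_gen M X h \<le> h\<^sup>2 / 2 - - \<gamma> / (2 * fact m) * h ^ m" using K by simp
    \<comment> \<open>the derivatives of \<open>K''\<close>, indexed from \<open>0\<close> for the second Taylor expansion\<close>
    define D where "D j = cgf_deriv (j + 2)" for j
    have D0: "D 0 = cgf_deriv 2" by (simp only: D_def add_0)
    obtain s where s: "\<bar>s\<bar> \<le> \<bar>h\<bar>"
      "cgf_deriv 2 h = (\<Sum>k<m - 2. D k 0 / fact k * h ^ k) + D (m - 2) s / fact (m - 2) * h ^ (m - 2)"
    proof -
      have "\<forall>j t. j < m - 2 \<and> \<bar>t\<bar> \<le> \<bar>h\<bar> \<longrightarrow> (D j has_real_derivative D (Suc j) t) (at t)"
        using h \<rho> unfolding D_def add_Suc by (intro allI impI cgf_deriv_has_derivative) linarith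
      then show thesis using Maclaurin_bi_le[of D, OF D0] that by blast
    qed
    have "(\<Sum>k<m - 2. D k 0 / fact k * h ^ k) = (\<Sum>k\<in>{0}. D k 0 / fact k * h ^ k)"
    proof (rule sum.mono_neutral_right)
      have "D i 0 = 0" if "i \<noteq> 0" "i < m - 2" for i
        unfolding D_def using that by (intro dk) auto
      then show "\<forall>i\<in>{..<m - 2} - {0}. D i 0 / fact i * h ^ i = 0" by simp
    qed (use m in auto)
    also have "\<dots> = 1" using d2 D0 by simp
    finally have sum1: "(\<Sum>k<m - 2. D k 0 / fact k * h ^ k) = 1" .
    have K2: "cgf_deriv 2 h = 1 + cgf_deriv m s / fact (m - 2) * h ^ (m - 2)"
    proof -
      have "2 \<le> m" using m by simp
      then have "D (m - 2) = cgf_deriv m" by (simp only: D_def le_add_diff_inverse2)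
      then show ?thesis using s(2) unfolding sum1 by simp
    qed
    have "(3 / 2 * \<gamma>) / fact (m - 2) * h ^ (m - 2) \<le> cgf_deriv m s / fact (m - 2) * h ^ (m - 2)"
      using near(1)[of s] s(1) h m by (intro mult_right_mono divide_right_mono zero_le_even_power) auto
    then show "1 - - 3 / 2 * \<gamma> / fact (m - 2) * h ^ (m - 2) \<le> cgf_deriv 2 h" using K2 by simp
  qed
qed

section \<open>The tilted characteristic function\<close>

text \<open>
  The moment generating function at \<open>h + i t\<close>; dividing by \<open>exp_moment 0 h\<close> gives the characteristic function
  of the tilted law of \<open>X\<close>.
\<close>

definition tilted_char :: "real \<Rightarrow> real \<Rightarrow> complex" where
  "tilted_char h t = (CLINT \<omega>|M. complex_of_real (exp (h * X \<omega>)) * iexp (t * X \<omega>))"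

lemma integrable_tilted:
  assumes "\<bar>h\<bar> < b"
  shows "integrable M (\<lambda>\<omega>. complex_of_real (exp (h * X \<omega>)) * iexp (t * X \<omega>))"
  by (rule Bochner_Integration.integrable_bound[OF integrable_exp[OF assms]])
     (auto simp: norm_mult)

lemma norm_tilted_char_sq:
  assumes h: "\<bar>h\<bar> < b"
  shows "(norm (tilted_char h t))\<^sup>2
    = (\<integral>\<omega>. exp (h * X \<omega>) * cos (t * X \<omega>) \<partial>M)\<^sup>2 + (\<integral>\<omega>. exp (h * X \<omega>) * sin (t * X \<omega>) \<partial>M)\<^sup>2"
proof -
  have "Re (tilted_char h t) = (\<integral>\<omega>. exp (h * X \<omega>) * cos (t * X \<omega>) \<partial>M)"
    unfolding tilted_char_def integral_Re[OF integrable_tilted[OF h], symmetric] by (simp add: Re_exp)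
  moreover have "Im (tilted_char h t) = (\<integral>\<omega>. exp (h * X \<omega>) * sin (t * X \<omega>) \<partial>M)"
    unfolding tilted_char_def integral_Im[OF integrable_tilted[OF h], symmetric] by (simp add: Im_exp)
  ultimately show ?thesis by (simp add: cmod_power2)
qed

text \<open>
  The squared modulus is the double integral of \<open>exp (h (x + y)) * cos (t (x - y))\<close> over two independent
  copies.  In the Taylor bound of the cosine, the quadratic term integrates to the tilted variance and the quartic term
  is bounded with \<open>(x - y) ^ 4 \<le> 8 * (x ^ 4 + y ^ 4)\<close>.  Working with iterated integrals, where all variables
  separate, avoids the product space.
\<close>

lemma norm_tilted_char_sq_le:
  assumes h: "\<bar>h\<bar> < b"
  shows "(norm (tilted_char h t))\<^sup>2 \<le> (exp_moment 0 h)\<^sup>2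
    - t\<^sup>2 * (exp_moment 2 h * exp_moment 0 h - (exp_moment 1 h)\<^sup>2)
    + 2 / 3 * t ^ 4 * (exp_moment 4 h * exp_moment 0 h)"
proof -
  let ?L = "\<lambda>k. exp_moment k h"
  let ?e = "\<lambda>\<omega>. exp (h * X \<omega>)"
  define C where "C = (\<integral>\<omega>. ?e \<omega> * cos (t * X \<omega>) \<partial>M)"
  define S where "S = (\<integral>\<omega>. ?e \<omega> * sin (t * X \<omega>) \<partial>M)"
  have ic: "integrable M (\<lambda>\<omega>. ?e \<omega> * cos (t * X \<omega>))"
    by (rule Bochner_Integration.integrable_bound[OF integrable_exp[OF h]])
       (auto simp: abs_mult mult_left_le)
  have isn: "integrable M (\<lambda>\<omega>. ?e \<omega> * sin (t * X \<omega>))"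
    by (rule Bochner_Integration.integrable_bound[OF integrable_exp[OF h]])
       (auto simp: abs_mult mult_left_le)
  have ik: "integrable M (\<lambda>\<omega>. X \<omega> ^ k * ?e \<omega>)" for k by (rule integrable_power_exp[OF h])
  have poly: "has_bochner_integral M (\<lambda>\<omega>. ?e \<omega> * (c0 + c1 * X \<omega> + c2 * X \<omega> ^ 2 + c4 * X \<omega> ^ 4))
      (c0 * ?L 0 + c1 * ?L 1 + c2 * ?L 2 + c4 * ?L 4)" for c0 c1 c2 c4 :: real
  proof -
    have L: "has_bochner_integral M (\<lambda>\<omega>. X \<omega> ^ k * ?e \<omega>) (?L k)" for k
      unfolding exp_moment_def by (rule has_bochner_integral_integrable[OF ik])
    have "has_bochner_integral M (\<lambda>\<omega>. c0 * (X \<omega> ^ 0 * ?e \<omega>) + c1 * (X \<omega> ^ 1 * ?e \<omega>)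
        + c2 * (X \<omega> ^ 2 * ?e \<omega>) + c4 * (X \<omega> ^ 4 * ?e \<omega>)) (c0 * ?L 0 + c1 * ?L 1 + c2 * ?L 2 + c4 * ?L 4)"
      by (intro has_bochner_integral_add has_bochner_integral_mult_right L)
    then show ?thesis by (simp add: algebra_simps)
  qed
  have inner: "cos (t * x) * C + sin (t * x) * S \<le>
      (1 - t\<^sup>2 * x\<^sup>2 / 2 + t ^ 4 * x ^ 4 / 3) * ?L 0 + t\<^sup>2 * x * ?L 1 + (- t\<^sup>2 / 2) * ?L 2 + (t ^ 4 / 3) * ?L 4" for x
  proof -
    have "has_bochner_integral M (\<lambda>\<omega>. cos (t * x) * (?e \<omega> * cos (t * X \<omega>)) + sin (t * x) * (?e \<omega> * sin (t * X \<omega>)))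
       (cos (t * x) * C + sin (t * x) * S)"
      unfolding C_def S_def
      by (intro has_bochner_integral_add has_bochner_integral_mult_right has_bochner_integral_integrable ic isn)
    then show ?thesis
    proof (rule has_bochner_integral_mono[OF _ poly[of "1 - t\<^sup>2 * x\<^sup>2 / 2 + t ^ 4 * x ^ 4 / 3" "t\<^sup>2 * x" "- t\<^sup>2 / 2" "t ^ 4 / 3"]])
      fix \<omega>
      let ?y = "X \<omega>"
      have "cos (t * x) * (?e \<omega> * cos (t * ?y)) + sin (t * x) * (?e \<omega> * sin (t * ?y)) = ?e \<omega> * cos (t * (x - ?y))"
        by (simp add: cos_diff right_diff_distrib distrib_left)
      also have "\<dots> \<le> ?e \<omega> * (1 - (t * (x - ?y))\<^sup>2 / 2 + (t * (x - ?y)) ^ 4 / 24)"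
        by (intro mult_left_mono cos_le_taylor4) auto
      also have "\<dots> \<le> ?e \<omega> * (1 - t\<^sup>2 * x\<^sup>2 / 2 + t ^ 4 * x ^ 4 / 3 + t\<^sup>2 * x * ?y + - t\<^sup>2 / 2 * ?y\<^sup>2 + t ^ 4 / 3 * ?y ^ 4)"
      proof (intro mult_left_mono)
        have "(x - ?y) ^ 4 \<le> 8 * (x ^ 4 + ?y ^ 4)"
        proof -
          have 1: "(x - ?y)\<^sup>2 \<le> 2 * (x\<^sup>2 + ?y\<^sup>2)"
            using zero_le_power2[of "x + ?y"] by (simp add: power2_eq_square algebra_simps)
          have "(x - ?y) ^ 4 = ((x - ?y)\<^sup>2)\<^sup>2" by simp
          also have "\<dots> \<le> (2 * (x\<^sup>2 + ?y\<^sup>2))\<^sup>2" by (intro power_mono 1) simp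
          also have "\<dots> \<le> 8 * (x ^ 4 + ?y ^ 4)"
            using zero_le_power2[of "x\<^sup>2 - ?y\<^sup>2"] by (simp add: power2_eq_square power4_eq_xxxx algebra_simps)
          finally show ?thesis .
        qed
        from mult_left_mono[OF this, of "t ^ 4"]
        have "(t * (x - ?y)) ^ 4 / 24 \<le> t ^ 4 / 3 * (x ^ 4 + ?y ^ 4)"
          by (simp add: power_mult_distrib distrib_left)
        moreover have "(t * (x - ?y))\<^sup>2 / 2 = t\<^sup>2 * x\<^sup>2 / 2 - t\<^sup>2 * x * ?y + t\<^sup>2 / 2 * ?y\<^sup>2"
          by (simp add: power2_eq_square field_simps)
        moreover have "t ^ 4 / 3 * (x ^ 4 + ?y ^ 4) = t ^ 4 * x ^ 4 / 3 + t ^ 4 / 3 * ?y ^ 4"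
          by (simp add: field_simps)
        ultimately show "1 - (t * (x - ?y))\<^sup>2 / 2 + (t * (x - ?y)) ^ 4 / 24
            \<le> 1 - t\<^sup>2 * x\<^sup>2 / 2 + t ^ 4 * x ^ 4 / 3 + t\<^sup>2 * x * ?y + - t\<^sup>2 / 2 * ?y\<^sup>2 + t ^ 4 / 3 * ?y ^ 4"
          by linarith
      qed simp
      finally show "cos (t * x) * (?e \<omega> * cos (t * ?y)) + sin (t * x) * (?e \<omega> * sin (t * ?y))
          \<le> ?e \<omega> * (1 - t\<^sup>2 * x\<^sup>2 / 2 + t ^ 4 * x ^ 4 / 3 + t\<^sup>2 * x * ?y + - t\<^sup>2 / 2 * ?y\<^sup>2 + t ^ 4 / 3 * ?y ^ 4)" .
    qed
  qed
  have "has_bochner_integral M (\<lambda>\<omega>. C * (?e \<omega> * cos (t * X \<omega>)) + S * (?e \<omega> * sin (t * X \<omega>))) (C * C + S * S)"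
    unfolding C_def S_def
    by (intro has_bochner_integral_add has_bochner_integral_mult_right has_bochner_integral_integrable ic isn)
  then have "C * C + S * S \<le> (?L 0 - t\<^sup>2 / 2 * ?L 2 + t ^ 4 / 3 * ?L 4) * ?L 0 + t\<^sup>2 * ?L 1 * ?L 1
      + (- (t\<^sup>2 / 2 * ?L 0)) * ?L 2 + (t ^ 4 / 3 * ?L 0) * ?L 4"
  proof (rule has_bochner_integral_mono[OF _ poly[of "?L 0 - t\<^sup>2 / 2 * ?L 2 + t ^ 4 / 3 * ?L 4" "t\<^sup>2 * ?L 1" "- (t\<^sup>2 / 2 * ?L 0)" "t ^ 4 / 3 * ?L 0"]])
    fix \<omega>
    let ?x = "X \<omega>"
    have "C * (?e \<omega> * cos (t * ?x)) + S * (?e \<omega> * sin (t * ?x)) = ?e \<omega> * (cos (t * ?x) * C + sin (t * ?x) * S)"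
      by (simp add: algebra_simps)
    also have "\<dots> \<le> ?e \<omega> * ((1 - t\<^sup>2 * ?x\<^sup>2 / 2 + t ^ 4 * ?x ^ 4 / 3) * ?L 0 + t\<^sup>2 * ?x * ?L 1 + (- t\<^sup>2 / 2) * ?L 2 + (t ^ 4 / 3) * ?L 4)"
      by (intro mult_left_mono inner) simp
    also have "\<dots> = ?e \<omega> * (?L 0 - t\<^sup>2 / 2 * ?L 2 + t ^ 4 / 3 * ?L 4 + t\<^sup>2 * ?L 1 * ?x
        + - (t\<^sup>2 / 2 * ?L 0) * ?x\<^sup>2 + t ^ 4 / 3 * ?L 0 * ?x ^ 4)"
      by (simp add: algebra_simps)
    finally show "C * (?e \<omega> * cos (t * ?x)) + S * (?e \<omega> * sin (t * ?x)) \<le> ?e \<omega> * (?L 0 - t\<^sup>2 / 2 * ?L 2 + t ^ 4 / 3 * ?L 4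
        + t\<^sup>2 * ?L 1 * ?x + - (t\<^sup>2 / 2 * ?L 0) * ?x\<^sup>2 + t ^ 4 / 3 * ?L 0 * ?x ^ 4)" .
  qed
  then show ?thesis
    unfolding norm_tilted_char_sq[OF h] C_def[symmetric] S_def[symmetric]
    by (simp add: power2_eq_square algebra_simps)
qed

text \<open>
  The bound is uniform in \<open>t\<close>, which transfers the gap at \<open>h = 0\<close> to small \<open>h\<close>.
\<close>

lemma tilted_char_near_untilted:
  assumes h: "\<bar>h\<bar> \<le> r" and r: "r < b"
  shows "norm (tilted_char h t - tilted_char 0 t) \<le> \<bar>h\<bar> * (\<integral>\<omega>. \<bar>X \<omega>\<bar> * exp (r * \<bar>X \<omega>\<bar>) \<partial>M)"
proof -
  have hb: "\<bar>h\<bar> < b" "\<bar>0\<bar> < b" using assms b_pos by auto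
  have int: "integrable M (\<lambda>\<omega>. \<bar>X \<omega>\<bar> * exp (r * \<bar>X \<omega>\<bar>))"
    using integrable_power_exp_abs[OF r, of 1] by simp
  have ptw: "\<bar>exp (h * X \<omega>) - 1\<bar> \<le> \<bar>h\<bar> * (\<bar>X \<omega>\<bar> * exp (r * \<bar>X \<omega>\<bar>))" for \<omega>
  proof -
    obtain s where s: "\<bar>s\<bar> \<le> \<bar>h * X \<omega>\<bar>" "exp (h * X \<omega>) = (\<Sum>m<1. (h * X \<omega>) ^ m / fact m) + exp s / fact 1 * (h * X \<omega>) ^ 1"
      using Maclaurin_exp_le[of "h * X \<omega>" 1] by blast
    have "\<bar>h * X \<omega>\<bar> \<le> r * \<bar>X \<omega>\<bar>" using h by (simp add: abs_mult mult_right_mono)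
    then have "exp s \<le> exp (r * \<bar>X \<omega>\<bar>)" using s(1) by simp
    then have "exp s * \<bar>h * X \<omega>\<bar> \<le> exp (r * \<bar>X \<omega>\<bar>) * \<bar>h * X \<omega>\<bar>" by (intro mult_right_mono) auto
    then show ?thesis using s(2) by (simp add: abs_mult mult_ac)
  qed
  have "tilted_char h t - tilted_char 0 t
      = (CLINT \<omega>|M. complex_of_real (exp (h * X \<omega>)) * iexp (t * X \<omega>) - complex_of_real (exp (0 * X \<omega>)) * iexp (t * X \<omega>))"
    unfolding tilted_char_def
    by (rule Bochner_Integration.integral_diff[symmetric]) (rule integrable_tilted hb)+
  also have "norm \<dots> \<le> (\<integral>\<omega>. \<bar>h\<bar> * (\<bar>X \<omega>\<bar> * exp (r * \<bar>X \<omega>\<bar>)) \<partial>M)"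
  proof (rule order_trans[OF integral_norm_bound integral_mono])
    show "integrable M (\<lambda>\<omega>. norm (complex_of_real (exp (h * X \<omega>)) * iexp (t * X \<omega>)
        - complex_of_real (exp (0 * X \<omega>)) * iexp (t * X \<omega>)))"
      by (intro integrable_norm Bochner_Integration.integrable_diff integrable_tilted hb)
    show "integrable M (\<lambda>\<omega>. \<bar>h\<bar> * (\<bar>X \<omega>\<bar> * exp (r * \<bar>X \<omega>\<bar>)))"
      by (intro integrable_mult_right int)
    fix \<omega>
    have "complex_of_real (exp (h * X \<omega>)) * iexp (t * X \<omega>) - complex_of_real (exp (0 * X \<omega>)) * iexp (t * X \<omega>)
       = complex_of_real (exp (h * X \<omega>) - 1) * iexp (t * X \<omega>)" by (simp add: left_diff_distrib)
    then show "norm (complex_of_real (exp (h * X \<omega>)) * iexp (t * X \<omega>) - complex_of_real (exp (0 * X \<omega>)) * iexp (t * X \<omega>))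
       \<le> \<bar>h\<bar> * (\<bar>X \<omega>\<bar> * exp (r * \<bar>X \<omega>\<bar>))"
      using ptw[of \<omega>] by (simp only: norm_mult norm_of_real norm_exp_i_times mult_1_right)
  qed
  also have "\<dots> = \<bar>h\<bar> * (\<integral>\<omega>. \<bar>X \<omega>\<bar> * exp (r * \<bar>X \<omega>\<bar>) \<partial>M)"
    by (rule integral_mult_right_zero)
  finally show ?thesis .
qed

lemma tilted_char_lipschitz:
  assumes h: "\<bar>h\<bar> < b"
  shows "norm (tilted_char h t - tilted_char h s) \<le> \<bar>t - s\<bar> * (\<integral>\<omega>. \<bar>X \<omega>\<bar> * exp (\<bar>h\<bar> * \<bar>X \<omega>\<bar>) \<partial>M)"
proof -
  have int: "integrable M (\<lambda>\<omega>. \<bar>X \<omega>\<bar> * exp (\<bar>h\<bar> * \<bar>X \<omega>\<bar>))"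
    using integrable_power_exp_abs[OF h, of 1] by simp
  have "tilted_char h t - tilted_char h s
      = (CLINT \<omega>|M. complex_of_real (exp (h * X \<omega>)) * iexp (t * X \<omega>) - complex_of_real (exp (h * X \<omega>)) * iexp (s * X \<omega>))"
    unfolding tilted_char_def
    by (rule Bochner_Integration.integral_diff[symmetric]) (rule integrable_tilted h)+
  also have "norm \<dots> \<le> (\<integral>\<omega>. \<bar>t - s\<bar> * (\<bar>X \<omega>\<bar> * exp (\<bar>h\<bar> * \<bar>X \<omega>\<bar>)) \<partial>M)"
  proof (rule order_trans[OF integral_norm_bound integral_mono])
    show "integrable M (\<lambda>\<omega>. norm (complex_of_real (exp (h * X \<omega>)) * iexp (t * X \<omega>)
        - complex_of_real (exp (h * X \<omega>)) * iexp (s * X \<omega>)))"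
      by (intro integrable_norm Bochner_Integration.integrable_diff integrable_tilted h)
    show "integrable M (\<lambda>\<omega>. \<bar>t - s\<bar> * (\<bar>X \<omega>\<bar> * exp (\<bar>h\<bar> * \<bar>X \<omega>\<bar>)))"
      by (intro integrable_mult_right int)
    fix \<omega>
    have split: "iexp (t * X \<omega>) - iexp (s * X \<omega>) = iexp (s * X \<omega>) * (iexp ((t - s) * X \<omega>) - 1)"
      by (simp add: right_diff_distrib left_diff_distrib exp_diff)
    have "norm (iexp ((t - s) * X \<omega>) - 1) \<le> \<bar>t - s\<bar> * \<bar>X \<omega>\<bar>"
      using iexp_approx1[of "(t - s) * X \<omega>" 0] by (simp add: abs_mult)
    then have "norm (iexp (t * X \<omega>) - iexp (s * X \<omega>)) \<le> \<bar>t - s\<bar> * \<bar>X \<omega>\<bar>"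
      unfolding split norm_mult norm_exp_i_times by simp
    then have "exp (h * X \<omega>) * norm (iexp (t * X \<omega>) - iexp (s * X \<omega>)) \<le> exp (\<bar>h\<bar> * \<bar>X \<omega>\<bar>) * (\<bar>t - s\<bar> * \<bar>X \<omega>\<bar>)"
      by (intro mult_mono) (auto simp flip: abs_mult)
    then show "norm (complex_of_real (exp (h * X \<omega>)) * iexp (t * X \<omega>) - complex_of_real (exp (h * X \<omega>)) * iexp (s * X \<omega>))
       \<le> \<bar>t - s\<bar> * (\<bar>X \<omega>\<bar> * exp (\<bar>h\<bar> * \<bar>X \<omega>\<bar>))"
      unfolding right_diff_distrib[symmetric] norm_mult norm_of_real by (simp add: mult_ac)
  qed
  also have "\<dots> = \<bar>t - s\<bar> * (\<integral>\<omega>. \<bar>X \<omega>\<bar> * exp (\<bar>h\<bar> * \<bar>X \<omega>\<bar>) \<partial>M)"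
    by (rule integral_mult_right_zero)
  finally show ?thesis .
qed

lemma tilted_char_isCont:
  assumes h: "\<bar>h\<bar> < b"
  shows "isCont (tilted_char h) t"
proof -
  define L where "L = (\<integral>\<omega>. \<bar>X \<omega>\<bar> * exp (\<bar>h\<bar> * \<bar>X \<omega>\<bar>) \<partial>M)"
  have "((\<lambda>s. \<bar>s - t\<bar> * L) \<longlongrightarrow> \<bar>t - t\<bar> * L) (at t)" by (intro tendsto_intros)
  then have "((\<lambda>s. \<bar>s - t\<bar> * L) \<longlongrightarrow> 0) (at t)" by simp
  then have "((\<lambda>s. tilted_char h s - tilted_char h t) \<longlongrightarrow> 0) (at t)"
    by (rule Lim_null_comparison[rotated])
       (use tilted_char_lipschitz[OF h] in \<open>auto simp: L_def\<close>)
  then show ?thesis unfolding isCont_def by (rule LIM_zero_cancel)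
qed

lemma tilted_char_measurable [measurable]:
  "tilted_char h \<in> borel_measurable borel"
  unfolding tilted_char_def[abs_def] by measurable

lemma tilted_char_0_right: "tilted_char h 0 = complex_of_real (exp_moment 0 h)"
  unfolding tilted_char_def exp_moment_def integral_complex_of_real[symmetric] by simp

lemma tilted_moments_near_0:
  assumes mean: "expectation X = 0" and var: "variance X = 1"
  obtains r D where "0 < r" "r \<le> b / 4" "0 \<le> D"
    "\<And>h. \<bar>h\<bar> \<le> r \<Longrightarrow> 1 / 2 \<le> exp_moment 0 h"
    "\<And>h. \<bar>h\<bar> \<le> r \<Longrightarrow> 1 / 2 \<le> cgf_deriv 2 h"
    "\<And>h. \<bar>h\<bar> \<le> r \<Longrightarrow> cgf_deriv 2 h \<le> 2"
    "\<And>h. \<bar>h\<bar> \<le> r \<Longrightarrow> 2 / 3 * (exp_moment 4 h / exp_moment 0 h) \<le> D"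
proof -
  have b0: "\<bar>0\<bar> < b" using b_pos by simp
  have m1: "exp_moment 1 0 = 0" using mean by (simp add: exp_moment_def)
  have m2: "exp_moment 2 0 = 1" using var mean by (simp add: exp_moment_def)
  have d2: "cgf_deriv 2 0 = 1" unfolding cgf_deriv_2[OF b0] exp_moment_0_0 m1 m2 by simp
  let ?Q = "\<lambda>h. exp_moment 4 h / exp_moment 0 h"
  have near: "\<exists>d>0. \<forall>h. \<bar>h\<bar> < d \<longrightarrow> \<bar>f h - f 0\<bar> < 1 / 2" if "isCont f 0" for f :: "real \<Rightarrow> real"
    using that[unfolded continuous_at_eps_delta, rule_format, of "1 / 2"] by (simp add: dist_real_def)
  obtain d0 where d0: "0 < d0" "\<And>h. \<bar>h\<bar> < d0 \<Longrightarrow> \<bar>exp_moment 0 h - exp_moment 0 0\<bar> < 1 / 2"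
    using near[OF exp_moment_isCont[OF b0, of 0]] by blast
  obtain d1 where d1: "0 < d1" "\<And>h. \<bar>h\<bar> < d1 \<Longrightarrow> \<bar>cgf_deriv 2 h - cgf_deriv 2 0\<bar> < 1 / 2"
    using near[OF cgf_deriv_isCont[OF b0, of 2]] by blast
  have "isCont ?Q 0"
    using exp_moment_isCont[OF b0] exp_moment_0_pos[OF b0] by (intro continuous_intros) auto
  then obtain d3 where d3: "0 < d3" "\<And>h. \<bar>h\<bar> < d3 \<Longrightarrow> \<bar>?Q h - ?Q 0\<bar> < 1 / 2"
    using near[of ?Q] by blast
  define r where "r = min (b / 4) (min (d0 / 2) (min (d1 / 2) (d3 / 2)))"
  have r: "0 < r" "r \<le> b / 4" "r < d0" "r < d1" "r < d3"
    using b_pos d0(1) d1(1) d3(1) by (auto simp: r_def)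
  have Q0: "0 \<le> ?Q 0" by (simp add: exp_moment_def)
  show thesis
  proof (rule that[of r "2 / 3 * (?Q 0 + 1)"])
    fix h :: real assume h: "\<bar>h\<bar> \<le> r"
    show "1 / 2 \<le> exp_moment 0 h" using d0(2)[of h] h r unfolding exp_moment_0_0 by linarith
    have "\<bar>cgf_deriv 2 h - 1\<bar> < 1 / 2" using d1(2)[of h] h r unfolding d2 by linarith
    then show "1 / 2 \<le> cgf_deriv 2 h" "cgf_deriv 2 h \<le> 2" by linarith+
    have "\<bar>?Q h - ?Q 0\<bar> < 1 / 2" using h r by (intro d3(2)) linarith
    then have "?Q h \<le> ?Q 0 + 1" unfolding abs_less_iff by argo
    then show "2 / 3 * ?Q h \<le> 2 / 3 * (?Q 0 + 1)" by (rule mult_left_mono) simp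
  qed (use r Q0 in auto)
qed

lemma norm_tilted_char_le_gaussian:
  assumes h: "\<bar>h\<bar> < b" and D: "2 / 3 * (exp_moment 4 h / exp_moment 0 h) \<le> D"
  shows "norm (tilted_char h t) / exp_moment 0 h \<le> exp ((- (t\<^sup>2 * cgf_deriv 2 h) + D * t ^ 4) / 2)"
proof -
  let ?L = "\<lambda>k. exp_moment k h"
  have L: "0 < ?L 0" by (rule exp_moment_0_pos[OF h])
  have "(norm (tilted_char h t) / ?L 0)\<^sup>2
      \<le> ((?L 0)\<^sup>2 - t\<^sup>2 * (?L 2 * ?L 0 - (?L 1)\<^sup>2) + 2 / 3 * t ^ 4 * (?L 4 * ?L 0)) / (?L 0)\<^sup>2"
    unfolding power_divide by (intro divide_right_mono norm_tilted_char_sq_le h) simp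
  also have "\<dots> = 1 - t\<^sup>2 * cgf_deriv 2 h + 2 / 3 * (?L 4 / ?L 0) * t ^ 4"
    unfolding cgf_deriv_2[OF h] using L by (simp add: field_simps power2_eq_square)
  also have "\<dots> \<le> 1 + (- (t\<^sup>2 * cgf_deriv 2 h) + D * t ^ 4)"
    using mult_right_mono[OF D, of "t ^ 4"] by simp
  also have "\<dots> \<le> exp (- (t\<^sup>2 * cgf_deriv 2 h) + D * t ^ 4)"
    by (rule exp_ge_add_one_self)
  also have "\<dots> = (exp ((- (t\<^sup>2 * cgf_deriv 2 h) + D * t ^ 4) / 2))\<^sup>2"
    by (simp add: exp_double[symmetric])
  finally show ?thesis by (rule power2_le_imp_le) simp
qed

lemma norm_tilted_char_0_le_1: "norm (tilted_char 0 t) \<le> 1"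
  unfolding tilted_char_def by (rule order_trans[OF integral_norm_bound]) (simp add: norm_mult prob_space)

text \<open>
  A Lipschitz function with an integrable power tends to zero: every point with value above \<open>1/2\<close>
  contributes a fixed amount to the integral over its neighbourhood.
\<close>

lemma tilted_char_0_decay:
  assumes int: "integrable lborel (\<lambda>t. norm (tilted_char 0 t) ^ k)"
  obtains T where "\<And>t. T \<le> \<bar>t\<bar> \<Longrightarrow> norm (tilted_char 0 t) \<le> 1 / 2"
proof -
  let ?F = "\<lambda>t. norm (tilted_char 0 t) ^ k"
  define \<Lambda> where "\<Lambda> = (\<integral>\<omega>. \<bar>X \<omega>\<bar> * exp (\<bar>0\<bar> * \<bar>X \<omega>\<bar>) \<partial>M)"
  have \<Lambda>: "0 \<le> \<Lambda>" by (simp add: \<Lambda>_def)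
  \<comment> \<open>within distance \<open>\<eta>\<close> the modulus drops by at most \<open>1/4\<close>, so it stays above \<open>1/4\<close>\<close>
  define \<eta> where "\<eta> = 1 / (4 * (\<Lambda> + 1))"
  have \<eta>: "0 < \<eta>" "\<eta> * \<Lambda> \<le> 1 / 4" using \<Lambda> by (auto simp: \<eta>_def field_simps)
  define c where "c = \<eta> * (1 / 4) ^ k"
  have c: "0 < c" using \<eta> by (simp add: c_def)
  have "(\<lambda>N::nat. \<integral>t. indicator {t. real N \<le> \<bar>t\<bar>} t * ?F t \<partial>lborel) \<longlonglongrightarrow> (\<integral>t. (0::real) \<partial>(lborel::real measure))"
  proof (rule integral_dominated_convergence[where w="?F"])
    show "AE t in lborel. (\<lambda>N::nat. indicator {t. real N \<le> \<bar>t\<bar>} t * ?F t) \<longlonglongrightarrow> 0"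
    proof (intro AE_I2 tendsto_eventually)
      fix t :: real
      obtain N :: nat where "\<bar>t\<bar> < real N" using reals_Archimedean2 by blast
      then show "\<forall>\<^sub>F N::nat in sequentially. indicator {t. real N \<le> \<bar>t\<bar>} t * ?F t = 0"
        by (intro eventually_sequentiallyI[of N]) (auto simp: indicator_def)
    qed
    show "AE t in lborel. norm (indicator {t. real N \<le> \<bar>t\<bar>} t * ?F t) \<le> ?F t" for N :: nat
      by (intro AE_I2) (auto simp: indicator_def)
  qed (use int in auto)
  then have "\<forall>\<^sub>F N in sequentially. (\<integral>t. indicator {t. real N \<le> \<bar>t\<bar>} t * ?F t \<partial>lborel) < c"
    using c by (intro order_tendstoD) auto
  then obtain N :: nat where N: "(\<integral>t. indicator {t. real N \<le> \<bar>t\<bar>} t * ?F t \<partial>lborel) < c"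
    by (auto simp: eventually_sequentially)
  show thesis
  proof (rule that[of "real N + \<eta>"], rule ccontr)
    fix t assume t: "real N + \<eta> \<le> \<bar>t\<bar>" and "\<not> norm (tilted_char 0 t) \<le> 1 / 2"
    then have big: "1 / 2 < norm (tilted_char 0 t)" by simp
    have F: "(1 / 4) ^ k \<le> ?F s" and sN: "real N \<le> \<bar>s\<bar>" if s: "s \<in> {t..t + \<eta>}" for s
    proof -
      have "norm (tilted_char 0 t - tilted_char 0 s) \<le> \<bar>t - s\<bar> * \<Lambda>"
        using tilted_char_lipschitz[of 0 t s] b_pos by (simp add: \<Lambda>_def)
      also have "\<dots> \<le> \<eta> * \<Lambda>" using s \<Lambda> by (intro mult_right_mono) auto
      finally have "1 / 4 \<le> norm (tilted_char 0 s)"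
        using big \<eta>(2) norm_triangle_ineq2[of "tilted_char 0 t" "tilted_char 0 s"] by linarith
      then show "(1 / 4) ^ k \<le> ?F s" by (intro power_mono) auto
      show "real N \<le> \<bar>s\<bar>" using s t \<eta> by auto
    qed
    have "c = (\<integral>s. indicator {t..t + \<eta>} s * (1 / 4) ^ k \<partial>lborel)" using \<eta> by (simp add: c_def)
    also have "\<dots> \<le> (\<integral>s. indicator {t. real N \<le> \<bar>t\<bar>} s * ?F s \<partial>lborel)"
    proof (rule integral_mono)
      show "integrable lborel (\<lambda>s. indicator {t. real N \<le> \<bar>t\<bar>} s * ?F s)"
        by (rule Bochner_Integration.integrable_bound[OF int]) (auto simp: indicator_def)
      show "indicator {t..t + \<eta>} s * (1 / 4) ^ k \<le> indicator {t. real N \<le> \<bar>t\<bar>} s * ?F s" for s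
        using F[of s] sN[of s] by (auto simp: indicator_def)
    qed (intro integrable_mult_left integrable_real_indicator, auto simp: emeasure_lborel_Icc_eq)
    finally show False using N by simp
  qed
qed

text \<open>
  At \<open>h = 0\<close> the maximum over the compact set \<open>\<delta> \<le> |t| \<le> T\<close> is attained and is below \<open>1\<close>, and
  beyond \<open>T\<close> the modulus is at most \<open>1/2\<close>.  Both \<open>tilted_char h t\<close> and
  \<open>exp_moment 0 h = tilted_char h 0\<close> are uniformly close to their values at \<open>h = 0\<close>.
\<close>

lemma tilted_char_gap:
  assumes lt1: "\<And>t. t \<noteq> 0 \<Longrightarrow> norm (tilted_char 0 t) < 1"
    and int: "integrable lborel (\<lambda>t. norm (tilted_char 0 t) ^ k)" and \<delta>: "0 < \<delta>"
  obtains r q where "0 < r" "0 < q" "q < 1"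
    "\<And>h t. \<bar>h\<bar> \<le> r \<Longrightarrow> \<delta> \<le> \<bar>t\<bar> \<Longrightarrow> norm (tilted_char h t) \<le> q * exp_moment 0 h"
proof -
  obtain T where T: "\<And>t. T \<le> \<bar>t\<bar> \<Longrightarrow> norm (tilted_char 0 t) \<le> 1 / 2"
    using tilted_char_0_decay[OF int] by blast
  define T' where "T' = max T \<delta>"
  let ?K = "{- T'..- \<delta>} \<union> {\<delta>..T'}"
  have "compact ?K" by (intro compact_Un compact_Icc)
  moreover have "?K \<noteq> {}" by (auto simp: T'_def)
  moreover have "continuous_on ?K (\<lambda>t. norm (tilted_char 0 t))"
    using tilted_char_isCont[of 0] b_pos by (intro continuous_intros continuous_at_imp_continuous_on) auto
  ultimately obtain t0 where t0: "t0 \<in> ?K" "\<And>t. t \<in> ?K \<Longrightarrow> norm (tilted_char 0 t) \<le> norm (tilted_char 0 t0)"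
    using continuous_attains_sup[of ?K "\<lambda>t. norm (tilted_char 0 t)"] by blast
  define q0 where "q0 = max (1 / 2) (norm (tilted_char 0 t0))"
  have "t0 \<noteq> 0" using t0(1) \<delta> by auto
  then have q0: "1 / 2 \<le> q0" "q0 < 1" using lt1 by (auto simp: q0_def)
  have gap0: "norm (tilted_char 0 t) \<le> q0" if "\<delta> \<le> \<bar>t\<bar>" for t
  proof (cases "T' \<le> \<bar>t\<bar>")
    case True
    then show ?thesis using T[of t] by (auto simp: q0_def T'_def)
  next
    case False
    then have "t \<in> ?K" using that by auto
    then show ?thesis using t0(2)[of t] by (auto simp: q0_def)
  qed
  define \<Lambda> where "\<Lambda> = (\<integral>\<omega>. \<bar>X \<omega>\<bar> * exp (b / 2 * \<bar>X \<omega>\<bar>) \<partial>M)"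
  have \<Lambda>: "0 \<le> \<Lambda>" by (simp add: \<Lambda>_def)
  \<comment> \<open>a change by at most \<open>(1 - q0) / 4\<close> keeps the quotient at most \<open>(1 + q0) / 2\<close>\<close>
  define r where "r = min (b / 2) ((1 - q0) / (4 * (\<Lambda> + 1)))"
  have r: "0 < r" "r \<le> b / 2" using b_pos q0 \<Lambda> by (simp_all add: r_def del: distrib_left_numeral)
  have r\<Lambda>: "r * \<Lambda> \<le> (1 - q0) / 4"
  proof -
    have "r * \<Lambda> \<le> (1 - q0) / (4 * (\<Lambda> + 1)) * (\<Lambda> + 1)"
      using \<Lambda> r by (intro mult_mono) (auto simp: r_def)
    moreover have "(1 - q0) / (4 * (\<Lambda> + 1)) * (\<Lambda> + 1) = (1 - q0) / 4"
      using \<Lambda> by (simp add: field_simps)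
    ultimately show ?thesis by linarith
  qed
  show thesis
  proof (rule that[of r "(1 + q0) / 2"])
    fix h t :: real assume h: "\<bar>h\<bar> \<le> r" and t: "\<delta> \<le> \<bar>t\<bar>"
    have near: "norm (tilted_char h s - tilted_char 0 s) \<le> (1 - q0) / 4" for s
    proof -
      have "norm (tilted_char h s - tilted_char 0 s) \<le> \<bar>h\<bar> * \<Lambda>"
        unfolding \<Lambda>_def using h r b_pos by (intro tilted_char_near_untilted) auto
      also have "\<dots> \<le> r * \<Lambda>" using h \<Lambda> by (intro mult_right_mono)
      finally show ?thesis using r\<Lambda> by simp
    qed
    have "norm (tilted_char h 0 - tilted_char 0 0) = \<bar>exp_moment 0 h - 1\<bar>"
      by (metis exp_moment_0_0 norm_of_real of_real_diff real_norm_def tilted_char_0_right)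
    then have L: "1 - (1 - q0) / 4 \<le> exp_moment 0 h" using near[of 0] by linarith
    have "norm (tilted_char h t) \<le> q0 + (1 - q0) / 4"
      using near[of t] gap0[OF t] norm_triangle_ineq2[of "tilted_char h t" "tilted_char 0 t"] by linarith
    also have "\<dots> \<le> (1 + q0) / 2 * (1 - (1 - q0) / 4)"
      using zero_le_power2[of "1 - q0"] by (simp add: power2_eq_square field_simps)
    also have "\<dots> \<le> (1 + q0) / 2 * exp_moment 0 h" using L q0 by (intro mult_left_mono) auto
    finally show "norm (tilted_char h t) \<le> (1 + q0) / 2 * exp_moment 0 h" .
  qed (use r q0 in auto)
qed

end

section \<open>Tilted laws of normalised sums\<close>

lemma countable_iexp_level_set:
  assumes "c \<noteq> 0"
  shows "countable {x::real. iexp (c * x) = z}"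
proof (cases "\<exists>x. iexp (c * x) = z")
  case True
  then obtain a where a: "iexp (c * a) = z" by blast
  have "{x. iexp (c * x) = z} \<subseteq> range (\<lambda>k::int. a + of_int (2 * k) * pi / c)"
  proof
    fix x assume "x \<in> {x. iexp (c * x) = z}"
    then have "iexp (c * x) = iexp (c * a)" using a by simp
    then obtain k :: int where "\<i> * complex_of_real (c * x) = \<i> * complex_of_real (c * a) + (of_int (2 * k) * pi) * \<i>"
      unfolding exp_eq by blast
    from arg_cong[OF this, of Im] have "c * x = c * a + of_int (2 * k) * pi" by simp
    then have "x = a + of_int (2 * k) * pi / c" using assms by (simp add: field_simps)
    then show "x \<in> range (\<lambda>k::int. a + of_int (2 * k) * pi / c)" by blast
  qed
  then show ?thesis by (rule countable_subset) auto
qed simp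

text \<open>
  Equality in the triangle inequality: \<open>1 - Re (W * cnj (E W))\<close> is nonnegative with integral zero.
\<close>

lemma (in prob_space) AE_eq_if_norm_expectation_eq_1:
  fixes W :: "'a \<Rightarrow> complex"
  assumes [measurable]: "W \<in> borel_measurable M" and W: "\<And>\<omega>. norm (W \<omega>) = 1"
    and E: "norm (expectation W) = 1"
  shows "AE \<omega> in M. W \<omega> = expectation W"
proof -
  let ?z = "expectation W"
  have int: "integrable M W" by (rule integrable_const_bound[where B=1]) (auto simp: W)
  have nz: "?z * cnj ?z = 1" using E by (simp add: complex_norm_square[symmetric])
  have int2: "integrable M (\<lambda>\<omega>. 1 - Re (W \<omega> * cnj ?z))"
    using int by (intro Bochner_Integration.integrable_diff integrable_Re integrable_mult_left) auto
  have le: "Re (W \<omega> * cnj ?z) \<le> 1" for \<omega>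
    using complex_Re_le_cmod[of "W \<omega> * cnj ?z"] by (simp add: norm_mult W E)
  have "(\<integral>\<omega>. 1 - Re (W \<omega> * cnj ?z) \<partial>M) = 1 - Re (expectation (\<lambda>\<omega>. W \<omega> * cnj ?z))"
    using int by (subst Bochner_Integration.integral_diff) (auto simp: prob_space)
  also have "\<dots> = 0" using nz by simp
  finally have "AE \<omega> in M. 1 - Re (W \<omega> * cnj ?z) = 0"
    using integral_nonneg_eq_0_iff_AE[OF int2] le by simp
  then show ?thesis
  proof eventually_elim
    case (elim \<omega>)
    let ?y = "W \<omega> * cnj ?z"
    have "norm ?y = 1" using W[of \<omega>] E by (simp add: norm_mult)
    then have "(Re ?y)\<^sup>2 + (Im ?y)\<^sup>2 = 1"
      unfolding cmod_power2[symmetric] by simp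
    then have "?y = 1" using elim by (simp add: complex_eq_iff)
    then have "?y * ?z = ?z" by simp
    then show ?case using nz by (simp add: mult.assoc mult.commute[of "cnj ?z"])
  qed
qed

locale iid_exponential_moments = exponential_moments +
  fixes Xs :: "nat \<Rightarrow> 'a \<Rightarrow> real"
  assumes indep: "indep_vars (\<lambda>_. borel) Xs {1..}"
    and identical: "\<And>k. 1 \<le> k \<Longrightarrow> distr M borel (Xs k) = distr M borel X"
begin

lemma Xs_measurable [measurable]: "1 \<le> k \<Longrightarrow> Xs k \<in> borel_measurable M"
  using indep by (auto simp: indep_vars_def)

lemma normalized_sum_measurable [measurable]: "normalized_sum Xs n \<in> borel_measurable M"
  unfolding normalized_sum_def[abs_def] by (intro borel_measurable_divide borel_measurable_sum) auto

lemma sum_eq_sqrt_normalized_sum: "1 \<le> n \<Longrightarrow> (\<Sum>k=1..n. Xs k \<omega>) = sqrt n * normalized_sum Xs n \<omega>"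
  by (simp add: normalized_sum_def)

lemma tilted_char_sum:
  assumes h: "\<bar>h\<bar> < b"
  shows "integrable M (\<lambda>\<omega>. complex_of_real (exp (h * (\<Sum>k=1..n. Xs k \<omega>))) * iexp (t * (\<Sum>k=1..n. Xs k \<omega>)))"
    and "(CLINT \<omega>|M. complex_of_real (exp (h * (\<Sum>k=1..n. Xs k \<omega>))) * iexp (t * (\<Sum>k=1..n. Xs k \<omega>)))
       = tilted_char h t ^ n"
proof -
  define g where "g x = complex_of_real (exp (h * x)) * iexp (t * x)" for x :: real
  have [measurable]: "g \<in> borel_measurable borel" unfolding g_def by measurable
  have prod: "complex_of_real (exp (h * (\<Sum>k=1..n. Xs k \<omega>))) * iexp (t * (\<Sum>k=1..n. Xs k \<omega>))
      = (\<Prod>k=1..n. g (Xs k \<omega>))" for \<omega>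
    by (simp add: g_def prod.distrib sum_distrib_left exp_sum)
  have ind: "indep_vars (\<lambda>_. borel) (\<lambda>k \<omega>. g (Xs k \<omega>)) {1..n}"
    by (rule indep_vars_compose2[OF indep_vars_subset[OF indep]]) auto
  have intg: "integrable M (\<lambda>\<omega>. g (X \<omega>))"
    unfolding g_def by (rule integrable_tilted[OF h])
  have intk: "integrable M (\<lambda>\<omega>. g (Xs k \<omega>))" and eqk: "(CLINT \<omega>|M. g (Xs k \<omega>)) = tilted_char h t"
    if k: "k \<in> {1..n}" for k
  proof -
    have k1: "1 \<le> k" using k by simp
    have [measurable]: "Xs k \<in> borel_measurable M" using k1 by measurable
    have "integrable (distr M borel (Xs k)) g"
      unfolding identical[OF k1] using intg by (subst integrable_distr_eq) auto
    then show "integrable M (\<lambda>\<omega>. g (Xs k \<omega>))" by (subst (asm) integrable_distr_eq) auto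
    have "(CLINT \<omega>|M. g (Xs k \<omega>)) = (CLINT x|distr M borel (Xs k). g x)"
      by (rule integral_distr[symmetric]) measurable
    also have "\<dots> = (CLINT \<omega>|M. g (X \<omega>))"
      unfolding identical[OF k1] by (rule integral_distr) measurable
    finally show "(CLINT \<omega>|M. g (Xs k \<omega>)) = tilted_char h t" by (simp add: tilted_char_def g_def)
  qed
  show "integrable M (\<lambda>\<omega>. complex_of_real (exp (h * (\<Sum>k=1..n. Xs k \<omega>))) * iexp (t * (\<Sum>k=1..n. Xs k \<omega>)))"
    unfolding prod by (rule indep_vars_integrable[OF _ ind intk]) auto
  show "(CLINT \<omega>|M. complex_of_real (exp (h * (\<Sum>k=1..n. Xs k \<omega>))) * iexp (t * (\<Sum>k=1..n. Xs k \<omega>)))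
       = tilted_char h t ^ n"
    unfolding prod by (subst indep_vars_lebesgue_integral[OF _ ind intk]) (auto simp: eqk)
qed

lemma exp_moment_sum:
  assumes h: "\<bar>h\<bar> < b"
  shows "integrable M (\<lambda>\<omega>. exp (h * (\<Sum>k=1..n. Xs k \<omega>)))"
    and "(\<integral>\<omega>. exp (h * (\<Sum>k=1..n. Xs k \<omega>)) \<partial>M) = exp_moment 0 h ^ n"
proof -
  have int: "integrable M (\<lambda>\<omega>. complex_of_real (exp (h * (\<Sum>k=1..n. Xs k \<omega>))))"
    using tilted_char_sum(1)[OF h, of n 0] by simp
  then show "integrable M (\<lambda>\<omega>. exp (h * (\<Sum>k=1..n. Xs k \<omega>)))"
    by (simp only: complex_of_real_integrable_eq)
  have "complex_of_real (\<integral>\<omega>. exp (h * (\<Sum>k=1..n. Xs k \<omega>)) \<partial>M) = complex_of_real (exp_moment 0 h ^ n)"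
    using tilted_char_sum(2)[OF h, of n 0]
    by (simp only: integral_complex_of_real[symmetric] tilted_char_0_right) simp
  then show "(\<integral>\<omega>. exp (h * (\<Sum>k=1..n. Xs k \<omega>)) \<partial>M) = exp_moment 0 h ^ n"
    by (simp only: of_real_eq_iff)
qed

text \<open>
  The exponent is \<open>h\<close> times the unnormalised sum, which is \<open>sqrt n * x\<close> where the normalised sum
  equals \<open>x\<close>.
\<close>

definition tilted_law :: "real \<Rightarrow> nat \<Rightarrow> real measure" where
  "tilted_law h n = density (distr M borel (normalized_sum Xs n))
     (\<lambda>x. ennreal (exp (h * sqrt n * x) / exp_moment 0 h ^ n))"

lemma tilted_law_0: "tilted_law 0 n = distr M borel (normalized_sum Xs n)"
  by (simp add: tilted_law_def exp_moment_0_0 density_1)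

lemma integral_tilted_law:
  fixes g :: "real \<Rightarrow> complex"
  assumes h: "\<bar>h\<bar> < b" and [measurable]: "g \<in> borel_measurable borel" and n: "1 \<le> n"
  shows "(CLINT x|tilted_law h n. g x)
    = (CLINT \<omega>|M. complex_of_real (exp (h * (\<Sum>k=1..n. Xs k \<omega>))) * g (normalized_sum Xs n \<omega>)) / exp_moment 0 h ^ n"
proof -
  have "(CLINT x|tilted_law h n. g x)
      = (CLINT x|distr M borel (normalized_sum Xs n). (exp (h * sqrt n * x) / exp_moment 0 h ^ n) *\<^sub>R g x)"
    unfolding tilted_law_def using exp_moment_0_pos[OF h] by (subst integral_density) auto
  also have "\<dots> = (CLINT \<omega>|M. (exp (h * sqrt n * normalized_sum Xs n \<omega>) / exp_moment 0 h ^ n) *\<^sub>R g (normalized_sum Xs n \<omega>))"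
    by (rule integral_distr) measurable
  also have "\<dots> = (CLINT \<omega>|M. complex_of_real (exp (h * (\<Sum>k=1..n. Xs k \<omega>))) * g (normalized_sum Xs n \<omega>) / exp_moment 0 h ^ n)"
    unfolding sum_eq_sqrt_normalized_sum[OF n] by (simp add: scaleR_conv_of_real mult.assoc exp_of_real)
  finally show ?thesis by simp
qed

lemma real_distribution_tilted_law:
  assumes h: "\<bar>h\<bar> < b" and n: "1 \<le> n"
  shows "real_distribution (tilted_law h n)"
proof -
  let ?Z = "normalized_sum Xs n"
  have pos: "0 < exp_moment 0 h ^ n" using exp_moment_0_pos[OF h] by simp
  have "emeasure (tilted_law h n) (space (tilted_law h n))
      = (\<integral>\<^sup>+\<omega>. ennreal (exp (h * sqrt n * ?Z \<omega>) / exp_moment 0 h ^ n) \<partial>M)"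
    unfolding tilted_law_def by (simp add: emeasure_density nn_integral_distr)
  also have "\<dots> = (\<integral>\<^sup>+\<omega>. ennreal (exp (h * (\<Sum>k=1..n. Xs k \<omega>)) / exp_moment 0 h ^ n) \<partial>M)"
    unfolding sum_eq_sqrt_normalized_sum[OF n] by (simp add: mult.assoc)
  also have "\<dots> = ennreal (\<integral>\<omega>. exp (h * (\<Sum>k=1..n. Xs k \<omega>)) / exp_moment 0 h ^ n \<partial>M)"
    using pos by (intro nn_integral_eq_integral integrable_divide exp_moment_sum(1)[OF h]) auto
  also have "\<dots> = 1"
    unfolding integral_divide_zero exp_moment_sum(2)[OF h] divide_self[OF less_imp_neq[OF pos, symmetric]] by simp
  finally have "prob_space (tilted_law h n)" by (rule prob_spaceI)
  then show ?thesis
    by (auto simp: real_distribution_def real_distribution_axioms_def tilted_law_def)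
qed

lemma char_tilted_law:
  assumes h: "\<bar>h\<bar> < b" and n: "1 \<le> n"
  shows "char (tilted_law h n) s = (tilted_char h (s / sqrt n) / exp_moment 0 h) ^ n"
proof -
  have "s / sqrt n * (\<Sum>k=1..n. Xs k \<omega>) = s * normalized_sum Xs n \<omega>" for \<omega>
    by (simp add: normalized_sum_def)
  then show ?thesis
    unfolding char_def using tilted_char_sum(2)[OF h, of n "s / sqrt n"]
    by (subst integral_tilted_law[OF h _ n]) (auto simp: power_divide simp del: of_real_mult times_divide_eq_left)
qed

text \<open>
  The law of the normalised sum and its tilted version both have continuous densities by Fourier inversion, and these
  densities differ by the exponential factor almost everywhere, hence everywhere.
\<close>

lemma density_le_tilted_char_integral:
  assumes n: "1 \<le> n" and h: "\<bar>h\<bar> < b"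
    and int0: "integrable lborel (\<lambda>s. norm (tilted_char 0 (s / sqrt n)) ^ n)"
    and inth: "integrable lborel (\<lambda>s. norm (tilted_char h (s / sqrt n)) ^ n)"
  shows "continuous_bounded_density M (normalized_sum Xs n) x
    \<le> exp_moment 0 h ^ n * exp (- (h * sqrt n * x))
       * ((\<integral>s. (norm (tilted_char h (s / sqrt n)) / exp_moment 0 h) ^ n \<partial>lborel) / (2 * pi))"
proof -
  let ?L = "exp_moment 0 h ^ n"
  have L: "0 < ?L" using exp_moment_0_pos[OF h] by simp
  have h0: "\<bar>0\<bar> < b" using b_pos by simp
  have nL: "norm (exp_moment 0 h) = exp_moment 0 h" using exp_moment_0_pos[OF h] by simp
  interpret T0: real_distribution "tilted_law 0 n" by (rule real_distribution_tilted_law[OF h0 n])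
  interpret Th: real_distribution "tilted_law h n" by (rule real_distribution_tilted_law[OF h n])
  have "integrable lborel (char (tilted_law 0 n))"
    by (rule Bochner_Integration.integrable_bound[OF int0])
       (auto simp: char_tilted_law[OF h0 n] exp_moment_0_0 norm_power)
  then obtain p :: "real \<Rightarrow> real" where p: "tilted_law 0 n = density lborel p" "continuous_on UNIV p" "\<And>y. 0 \<le> p y"
    "\<And>y. p y \<le> (\<integral>t. norm (char (tilted_law 0 n) t) \<partial>lborel) / (2 * pi)"
    using T0.fourier_inversion_density by blast
  have "integrable lborel (char (tilted_law h n))"
  proof (rule Bochner_Integration.integrable_bound)
    show "integrable lborel (\<lambda>s. norm (tilted_char h (s / sqrt n)) ^ n / ?L)"
      by (intro integrable_divide inth)
  qed (use exp_moment_0_pos[OF h] in \<open>auto simp: char_tilted_law[OF h n] norm_power norm_divide power_divide\<close>)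
  then obtain q :: "real \<Rightarrow> real" where q: "tilted_law h n = density lborel q" "continuous_on UNIV q" "\<And>y. 0 \<le> q y"
    "\<And>y. q y \<le> (\<integral>t. norm (char (tilted_law h n) t) \<partial>lborel) / (2 * pi)"
    using Th.fourier_inversion_density by blast
  have [measurable]: "p \<in> borel_measurable borel" using p(2) by (rule borel_measurable_continuous_onI)
  have cbd: "continuous_bounded_density M (normalized_sum Xs n) = p"
    using p by (intro continuous_bounded_density_eq) (auto simp: tilted_law_0)
  let ?w = "\<lambda>x. exp (h * sqrt n * x) / ?L"
  have "density lborel q = density (density lborel p) ?w"
    unfolding q(1)[symmetric] p(1)[symmetric] tilted_law_0 tilted_law_def[of h] ..
  also have "\<dots> = density lborel (\<lambda>x. ennreal (p x) * ennreal (?w x))"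
    by (rule density_density_eq) measurable
  also have "\<dots> = density lborel (\<lambda>x. ennreal (p x * ?w x))"
    using p(3) L by (subst ennreal_mult) (auto intro: divide_nonneg_pos)
  finally have "q = (\<lambda>x. p x * ?w x)"
    using p L by (intro continuous_density_unique q) (auto intro!: continuous_intros)
  then have "p x = ?L * exp (- (h * sqrt n * x)) * q x"
    using exp_moment_0_pos[OF h] by (simp add: exp_minus field_simps)
  also have "\<dots> \<le> ?L * exp (- (h * sqrt n * x)) * ((\<integral>t. norm (char (tilted_law h n) t) \<partial>lborel) / (2 * pi))"
    using L by (intro mult_left_mono q) auto
  also have "(\<lambda>t. norm (char (tilted_law h n) t)) = (\<lambda>s. (norm (tilted_char h (s / sqrt n)) / exp_moment 0 h) ^ n)"
    by (simp add: char_tilted_law[OF h n] norm_power norm_divide nL[unfolded real_norm_def])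
  finally show ?thesis by (simp add: cbd)
qed

text \<open>
  If \<open>f \<le> A\<close> is the density of \<open>Z_n\<close>, then \<open>u x = f x * exp (h * sqrt n * x)\<close> satisfies
  \<open>(u x)\<^sup>2 \<le> A * f x * exp (2 * h * sqrt n * x)\<close>, whose integral is \<open>A * exp_moment 0 (2 * h) ^ n\<close>.
  The Fourier transform of \<open>u\<close> is the rescaled \<open>n\<close>-th power of \<open>tilted_char h\<close>, so the Plancherel
  inequality applies.  The range \<open>|h| \<le> b / 4\<close> keeps \<open>2 * h\<close> uniformly inside the domain of the moments.
\<close>

lemma tilted_char_square_integrable:
  assumes n: "1 \<le> n" and dens: "has_bounded_density M (normalized_sum Xs n)"
  obtains B where "0 \<le> B"
    "\<And>h. \<bar>h\<bar> \<le> b / 4 \<Longrightarrow> integrable lborel (\<lambda>t. norm (tilted_char h t) ^ (2 * n))"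
    "\<And>h. \<bar>h\<bar> \<le> b / 4 \<Longrightarrow> (\<integral>t. norm (tilted_char h t) ^ (2 * n) \<partial>lborel) \<le> B"
proof -
  let ?Z = "normalized_sum Xs n"
  obtain f where f: "distributed M lborel ?Z (\<lambda>x. ennreal (f x))" "\<And>x. 0 \<le> f x" "bounded (range f)"
    using dens by (auto simp: has_bounded_density_def)
  obtain A where A: "\<And>x. f x \<le> A" "0 \<le> A"
    using f(3) f(2) by (auto simp: bounded_iff abs_le_iff intro: order_trans)
  have [measurable]: "f \<in> borel_measurable borel"
    using distributed_real_measurable[OF _ f(1)] f(2) by simp
  have law: "distr M borel ?Z = density lborel f"
    using f(1) distr_cong[of M M lborel borel ?Z ?Z] by (simp add: distributed_def)
  have transfer: "(LINT x|lborel. f x *\<^sub>R g x) = (LINT \<omega>|M. g (?Z \<omega>))"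
    "integrable lborel (\<lambda>x. f x *\<^sub>R g x) \<longleftrightarrow> integrable M (\<lambda>\<omega>. g (?Z \<omega>))"
    if [measurable]: "g \<in> borel_measurable borel" for g :: "real \<Rightarrow> 'c::{banach, second_countable_topology}"
  proof -
    have "(LINT x|lborel. f x *\<^sub>R g x) = (LINT x|density lborel f. g x)"
      using f(2) by (subst integral_density) auto
    also have "\<dots> = (LINT \<omega>|M. g (?Z \<omega>))"
      unfolding law[symmetric] by (rule integral_distr) measurable
    finally show "(LINT x|lborel. f x *\<^sub>R g x) = (LINT \<omega>|M. g (?Z \<omega>))" .
    have "integrable lborel (\<lambda>x. f x *\<^sub>R g x) \<longleftrightarrow> integrable (density lborel f) g"
      using f(2) by (subst integrable_density) auto
    also have "\<dots> \<longleftrightarrow> integrable M (\<lambda>\<omega>. g (?Z \<omega>))"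
      unfolding law[symmetric] by (rule integrable_distr_eq) measurable
    finally show "integrable lborel (\<lambda>x. f x *\<^sub>R g x) \<longleftrightarrow> integrable M (\<lambda>\<omega>. g (?Z \<omega>))" .
  qed
  define E where "E = (\<integral>\<omega>. exp (b / 2 * \<bar>X \<omega>\<bar>) \<partial>M)"
  have intE: "integrable M (\<lambda>\<omega>. exp (b / 2 * \<bar>X \<omega>\<bar>))"
    using integrable_power_exp_abs[of "b / 2" 0] b_pos by simp
  define B where "B = 2 * pi * (A * E ^ n) / sqrt n"
  have main: "integrable lborel (\<lambda>t. norm (tilted_char h t) ^ (2 * n)) \<and>
      (\<integral>t. norm (tilted_char h t) ^ (2 * n) \<partial>lborel) \<le> B" if h: "\<bar>h\<bar> \<le> b / 4" for h
  proof -
    have hb: "\<bar>h\<bar> < b" and h2: "\<bar>2 * h\<bar> < b" using h b_pos by auto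
    define u where "u x = f x * exp (h * sqrt n * x)" for x
    have [measurable]: "u \<in> borel_measurable borel" unfolding u_def by measurable
    have upos: "0 \<le> u x" for x using f(2) by (simp add: u_def)
    have e2: "exp (2 * h * (\<Sum>k=1..n. Xs k \<omega>)) = exp (2 * h * sqrt n * ?Z \<omega>)"
      "exp (h * (\<Sum>k=1..n. Xs k \<omega>)) = exp (h * sqrt n * ?Z \<omega>)" for \<omega>
      unfolding sum_eq_sqrt_normalized_sum[OF n] by (simp_all add: mult.assoc)
    have intu: "integrable lborel u"
      using transfer(2)[of "\<lambda>x. exp (h * sqrt n * x)"] exp_moment_sum(1)[OF hb, of n, unfolded e2]
      by (simp add: u_def[abs_def])
    have int2: "integrable lborel (\<lambda>x. f x * exp (2 * h * sqrt n * x))"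
      "(\<integral>x. f x * exp (2 * h * sqrt n * x) \<partial>lborel) = exp_moment 0 (2 * h) ^ n"
      using transfer[of "\<lambda>x. exp (2 * h * sqrt n * x)"] exp_moment_sum[OF h2, of n, unfolded e2]
      by simp_all
    have usq: "(u x)\<^sup>2 \<le> A * (f x * exp (2 * h * sqrt n * x))" for x
    proof -
      have "(u x)\<^sup>2 = f x * (f x * exp (2 * h * sqrt n * x))"
        by (simp add: u_def power2_eq_square mult_ac flip: exp_add)
      also have "\<dots> \<le> A * (f x * exp (2 * h * sqrt n * x))"
        using A f(2) by (intro mult_right_mono) auto
      finally show ?thesis .
    qed
    have intu2: "integrable lborel (\<lambda>x. (u x)\<^sup>2)"
      by (rule Bochner_Integration.integrable_bound[OF integrable_mult_right[OF int2(1), of A]])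
         (use usq in \<open>auto intro: order_trans[OF _ abs_ge_self]\<close>)
    have "(\<integral>x. (u x)\<^sup>2 \<partial>lborel) \<le> (\<integral>x. A * (f x * exp (2 * h * sqrt n * x)) \<partial>lborel)"
      by (rule integral_mono[OF intu2 integrable_mult_right[OF int2(1)] usq])
    also have "\<dots> = A * exp_moment 0 (2 * h) ^ n"
      by (simp only: integral_mult_right_zero int2(2))
    also have "\<dots> \<le> A * E ^ n"
    proof (intro mult_left_mono power_mono A)
      show "exp_moment 0 (2 * h) \<le> E"
        unfolding exp_moment_def E_def
      proof (rule integral_mono[OF integrable_power_exp[OF h2] intE])
        fix \<omega>
        have "2 * h * X \<omega> \<le> \<bar>2 * h\<bar> * \<bar>X \<omega>\<bar>" by (simp flip: abs_mult)
        also have "\<dots> \<le> b / 2 * \<bar>X \<omega>\<bar>" using h by (intro mult_right_mono) auto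
        finally show "X \<omega> ^ 0 * exp (2 * h * X \<omega>) \<le> exp (b / 2 * \<bar>X \<omega>\<bar>)" by simp
      qed
      show "0 \<le> exp_moment 0 (2 * h)" using exp_moment_0_pos[OF h2] by simp
    qed
    finally have u2_le: "(\<integral>x. (u x)\<^sup>2 \<partial>lborel) \<le> A * E ^ n" .
    have ft: "fourier_transform u t = tilted_char h (t / sqrt n) ^ n" for t
    proof -
      have "fourier_transform u t = (CLINT x|lborel. f x *\<^sub>R (complex_of_real (exp (h * sqrt n * x)) * iexp (t * x)))"
        by (simp add: fourier_transform_def u_def scaleR_conv_of_real mult_ac)
      also have "\<dots> = (CLINT \<omega>|M. complex_of_real (exp (h * sqrt n * ?Z \<omega>)) * iexp (t * ?Z \<omega>))"
        by (rule transfer) measurable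
      also have "\<dots> = tilted_char h (t / sqrt n) ^ n"
        unfolding tilted_char_sum(2)[OF hb, symmetric] e2
        by (simp add: normalized_sum_def)
      finally show ?thesis .
    qed
    let ?G = "\<lambda>t. norm (tilted_char h t) ^ (2 * n)"
    have G: "(norm (fourier_transform u t))\<^sup>2 = ?G (0 + 1 / sqrt n * t)" for t
      by (simp add: ft norm_power power_mult[symmetric] mult.commute)
    note pl = plancherel_inequality[OF intu intu2 upos, unfolded G]
    have sn: "1 / sqrt n \<noteq> 0" using n by simp
    have "integrable lborel ?G"
      using pl(1) lborel_integrable_real_affine_iff[OF sn, of ?G 0] by simp
    moreover have "(\<integral>t. ?G t \<partial>lborel) = \<bar>1 / sqrt n\<bar> *\<^sub>R (\<integral>t. ?G (0 + 1 / sqrt n * t) \<partial>lborel)"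
      by (rule lborel_integral_real_affine[OF sn])
    then have "(\<integral>t. ?G t \<partial>lborel) \<le> 1 / sqrt n * (2 * pi * (A * E ^ n))"
      using pl(2) u2_le by (simp add: divide_right_mono order_trans)
    ultimately show ?thesis by (simp add: B_def)
  qed
  have "0 \<le> B" using A(2) by (auto simp: B_def E_def)
  with main show thesis by (intro that[of B]) auto
qed

text \<open>
  Otherwise \<open>exp (i t (X_1 + ... + X_n))\<close> is almost surely constant, so that the normalised sum lies in a countable
  set almost surely, which a law with a density does not allow.
\<close>

lemma norm_tilted_char_0_lt_1:
  assumes n: "1 \<le> n" and dens: "has_bounded_density M (normalized_sum Xs n)" and t: "t \<noteq> 0"
  shows "norm (tilted_char 0 t) < 1"
proof (rule ccontr)
  assume "\<not> norm (tilted_char 0 t) < 1"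
  with norm_tilted_char_0_le_1[of t] have n1: "norm (tilted_char 0 t) = 1" by simp
  let ?Z = "normalized_sum Xs n"
  let ?W = "\<lambda>\<omega>. iexp (t * sqrt n * ?Z \<omega>)"
  have h0: "\<bar>0\<bar> < b" using b_pos by simp
  have "expectation ?W = tilted_char 0 t ^ n"
    using tilted_char_sum(2)[OF h0, of n t] unfolding sum_eq_sqrt_normalized_sum[OF n] by (simp add: mult.assoc)
  then have "norm (expectation ?W) = 1" by (simp add: norm_power n1)
  then have W: "AE \<omega> in M. ?W \<omega> = expectation ?W"
    by (intro AE_eq_if_norm_expectation_eq_1) auto
  define D where "D = {x. iexp (t * sqrt n * x) = expectation ?W}"
  have "countable D"
    unfolding D_def using countable_iexp_level_set[of "t * sqrt n" "expectation ?W"] t n by simp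
  then have D: "AE x in lborel. x \<notin> D"
    by (rule AE_not_in[OF countable_imp_null_set_lborel])
  obtain f where f: "distributed M lborel ?Z (\<lambda>x. ennreal (f x))"
    using dens by (auto simp: has_bounded_density_def)
  have "AE x in density lborel (\<lambda>x. ennreal (f x)). x \<notin> D"
    unfolding AE_density[OF distributed_borel_measurable[OF f]] using D by eventually_elim simp
  then have "AE x in distr M lborel ?Z. x \<notin> D"
    unfolding distributed_distr_eq_density[OF f] .
  then have "AE \<omega> in M. ?Z \<omega> \<notin> D"
    by (rule AE_distrD[OF distributed_measurable[OF f]])
  with W have "AE \<omega> in M. False"
    by eventually_elim (simp add: D_def)
  then show False by (simp add: AE_False)
qed

section \<open>The density estimate\<close>

text \<open>
  The integrand is dominated by three terms: the Gaussian with variance \<open>1 / K'' h\<close>, a Gaussian correction of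
  order \<open>1/n\<close> from the quartic term, and, for \<open>|s| > \<delta> * sqrt n\<close>, the integrable power \<open>2 n_0\<close> times
  \<open>q ^ (n - 2 n_0)\<close>.
\<close>

lemma tilted_char_power_integral_le:
  assumes mean: "expectation X = 0" and var: "variance X = 1"
    and n0: "1 \<le> n\<^sub>0" and dens: "has_bounded_density M (normalized_sum Xs n\<^sub>0)"
  obtains r C where "0 < r" "r \<le> b / 4" "0 \<le> C"
    "\<And>h. \<bar>h\<bar> \<le> r \<Longrightarrow> 1 / 2 \<le> cgf_deriv 2 h"
    "\<And>h n. \<bar>h\<bar> \<le> r \<Longrightarrow> 2 * n\<^sub>0 \<le> n \<Longrightarrow> integrable lborel (\<lambda>s. norm (tilted_char h (s / sqrt n)) ^ n)"
    "\<And>h n. \<bar>h\<bar> \<le> r \<Longrightarrow> 2 * n\<^sub>0 \<le> n \<Longrightarrow>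
      (\<integral>s. (norm (tilted_char h (s / sqrt n)) / exp_moment 0 h) ^ n \<partial>lborel)
        \<le> sqrt (2 * pi / cgf_deriv 2 h) * (1 + C / n)"
proof -
  obtain B where B: "0 \<le> B"
    "\<And>h. \<bar>h\<bar> \<le> b / 4 \<Longrightarrow> integrable lborel (\<lambda>t. norm (tilted_char h t) ^ (2 * n\<^sub>0))"
    "\<And>h. \<bar>h\<bar> \<le> b / 4 \<Longrightarrow> (\<integral>t. norm (tilted_char h t) ^ (2 * n\<^sub>0) \<partial>lborel) \<le> B"
    using tilted_char_square_integrable[OF n0 dens] by blast
  obtain r1 D where r1: "0 < r1" "r1 \<le> b / 4" and D: "0 \<le> D"
    and near: "\<And>h. \<bar>h\<bar> \<le> r1 \<Longrightarrow> 1 / 2 \<le> exp_moment 0 h"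
      "\<And>h. \<bar>h\<bar> \<le> r1 \<Longrightarrow> 1 / 2 \<le> cgf_deriv 2 h"
      "\<And>h. \<bar>h\<bar> \<le> r1 \<Longrightarrow> cgf_deriv 2 h \<le> 2"
      "\<And>h. \<bar>h\<bar> \<le> r1 \<Longrightarrow> 2 / 3 * (exp_moment 4 h / exp_moment 0 h) \<le> D"
    using tilted_moments_near_0[OF mean var] by blast
  \<comment> \<open>ensures \<open>D * t\<^sup>2 \<le> 1/8\<close> for \<open>|t| \<le> \<delta>\<close>, so that the quartic term stays below the quadratic one\<close>
  define \<delta> where "\<delta> = 1 / (4 * (D + 1))"
  have \<delta>: "0 < \<delta>" using D by (simp add: \<delta>_def)
  have D\<delta>: "D * t\<^sup>2 \<le> 1 / 8" if "\<bar>t\<bar> \<le> \<delta>" for t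
  proof -
    have "D * t\<^sup>2 \<le> (D + 1) * \<delta>\<^sup>2"
      using that D power_mono[OF that, of 2] by (intro mult_mono) auto
    also have "\<dots> = 1 / (16 * (D + 1))"
    proof -
      have "E * (1 / (4 * E))\<^sup>2 = 1 / (16 * E)" if "E \<noteq> 0" for E :: real
        using that by (simp add: power2_eq_square)
      from this[of "D + 1"] show ?thesis using D by (simp add: \<delta>_def)
    qed
    also have "\<dots> \<le> 1 / 8" using D by (simp add: field_simps)
    finally show ?thesis .
  qed
  have b40: "\<bar>0\<bar> \<le> b / 4" using b_pos by simp
  obtain r2 q where r2: "0 < r2" and q: "0 < q" "q < 1"
    and gap: "\<And>h t. \<bar>h\<bar> \<le> r2 \<Longrightarrow> \<delta> \<le> \<bar>t\<bar> \<Longrightarrow> norm (tilted_char h t) \<le> q * exp_moment 0 h"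
    using tilted_char_gap[OF norm_tilted_char_0_lt_1[OF n0 dens] B(2)[OF b40] \<delta>] by blast
  define r where "r = min r1 r2"
  have r: "0 < r" "r \<le> r1" "r \<le> r2" "r \<le> b / 4" using r1 r2 by (auto simp: r_def)
  define c1 where "c1 = 256 * D * sqrt (2 * pi / (1 / 4))"
  define c2 where "c2 = 2 ^ (2 * n\<^sub>0) * B * (2 / (ln q)\<^sup>2) / q ^ (2 * n\<^sub>0)"
  \<comment> \<open>dividing by \<open>sqrt pi \<le> sqrt (2 * pi / K'' h)\<close> turns the additive error into a relative one\<close>
  define C where "C = (c1 + c2) / sqrt pi"
  have c: "0 \<le> c1" "0 \<le> c2" "0 \<le> C" using D B(1) q by (auto simp: c1_def c2_def C_def)
  have main: "integrable lborel (\<lambda>s. norm (tilted_char h (s / sqrt n)) ^ n) \<and>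
      (\<integral>s. (norm (tilted_char h (s / sqrt n)) / exp_moment 0 h) ^ n \<partial>lborel) \<le> sqrt (2 * pi / cgf_deriv 2 h) * (1 + C / n)"
    if h: "\<bar>h\<bar> \<le> r" and n: "2 * n\<^sub>0 \<le> n" for h n
  proof -
    have hb: "\<bar>h\<bar> < b" "\<bar>h\<bar> \<le> b / 4" "\<bar>h\<bar> \<le> r1" "\<bar>h\<bar> \<le> r2" using h r b_pos by auto
    have n1: "1 \<le> n" using n n0 by simp
    define v where "v = cgf_deriv 2 h"
    have v: "1 / 2 \<le> v" "v \<le> 2" using near hb unfolding v_def by auto
    define L where "L = exp_moment 0 h"
    have L: "1 / 2 \<le> L" "0 < L" using near(1)[OF hb(3)] unfolding L_def by auto
    define \<psi> where "\<psi> t = norm (tilted_char h t) / L" for t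
    have \<psi>0: "0 \<le> \<psi> t" for t using L by (simp add: \<psi>_def)
    have [measurable]: "\<psi> \<in> borel_measurable borel" unfolding \<psi>_def by measurable
    let ?d = "\<lambda>s. exp (- (v * s\<^sup>2 / 2)) + 256 * D / n * exp (- (1 / 4 * s\<^sup>2 / 2)) + q ^ (n - 2 * n\<^sub>0) * \<psi> (s / sqrt n) ^ (2 * n\<^sub>0)"
    have dom: "\<psi> (s / sqrt n) ^ n \<le> ?d s" for s
    proof (cases "\<bar>s / sqrt n\<bar> \<le> \<delta>")
      case True
      have "\<psi> (s / sqrt n) ^ n \<le> exp ((- ((s / sqrt n)\<^sup>2 * v) + D * (s / sqrt n) ^ 4) / 2) ^ n"
        using norm_tilted_char_le_gaussian[OF hb(1) near(4)[OF hb(3)], of "s / sqrt n"] \<psi>0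
        by (intro power_mono) (auto simp: \<psi>_def L_def v_def)
      also have "\<dots> \<le> exp (- (v * s\<^sup>2 / 2)) + 256 * D / n * exp (- (1 / 4 * s\<^sup>2 / 2))"
        by (rule gaussian_quartic_exp_power_le[OF n1 D v(1) D\<delta>[OF True]])
      also have "\<dots> \<le> ?d s" using q \<psi>0 by simp
      finally show ?thesis .
    next
      case False
      have "\<psi> (s / sqrt n) \<le> q"
        using gap[OF hb(4), of "s / sqrt n"] False L by (simp add: \<psi>_def L_def field_simps)
      then have "\<psi> (s / sqrt n) ^ (n - 2 * n\<^sub>0) \<le> q ^ (n - 2 * n\<^sub>0)" using \<psi>0 by (intro power_mono)
      then have "\<psi> (s / sqrt n) ^ (n - 2 * n\<^sub>0) * \<psi> (s / sqrt n) ^ (2 * n\<^sub>0) \<le> q ^ (n - 2 * n\<^sub>0) * \<psi> (s / sqrt n) ^ (2 * n\<^sub>0)"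
        using \<psi>0 by (intro mult_right_mono) auto
      also have "\<psi> (s / sqrt n) ^ (n - 2 * n\<^sub>0) * \<psi> (s / sqrt n) ^ (2 * n\<^sub>0) = \<psi> (s / sqrt n) ^ n"
        using n by (simp flip: power_add)
      also have "q ^ (n - 2 * n\<^sub>0) * \<psi> (s / sqrt n) ^ (2 * n\<^sub>0) \<le> ?d s" using D by (simp add: add_nonneg_nonneg)
      finally show ?thesis .
    qed
    define I where "I = (\<integral>s. \<psi> (s / sqrt n) ^ (2 * n\<^sub>0) \<partial>lborel)"
    have tail: "integrable lborel (\<lambda>s. \<psi> (s / sqrt n) ^ (2 * n\<^sub>0))" and I: "I \<le> sqrt n * (2 ^ (2 * n\<^sub>0) * B)"
    proof -
      let ?G = "\<lambda>t. \<psi> t ^ (2 * n\<^sub>0)"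
      have sn: "1 / sqrt n \<noteq> 0" using n1 by simp
      have G: "?G = (\<lambda>t. norm (tilted_char h t) ^ (2 * n\<^sub>0) / L ^ (2 * n\<^sub>0))"
        by (simp add: \<psi>_def power_divide)
      have intG: "integrable lborel ?G" unfolding G by (intro integrable_divide B hb)
      then show "integrable lborel (\<lambda>s. \<psi> (s / sqrt n) ^ (2 * n\<^sub>0))"
        using lborel_integrable_real_affine_iff[OF sn, of ?G 0] by simp
      have "(\<integral>t. ?G t \<partial>lborel) = 1 / sqrt n * I"
        using lborel_integral_real_affine[OF sn, of ?G 0] by (simp add: I_def)
      then have "I = sqrt n * (\<integral>t. ?G t \<partial>lborel)" using n1 by simp
      also have "\<dots> \<le> sqrt n * (2 ^ (2 * n\<^sub>0) * B)"
      proof (rule mult_left_mono)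
        have "(\<integral>t. ?G t \<partial>lborel) = (\<integral>t. norm (tilted_char h t) ^ (2 * n\<^sub>0) \<partial>lborel) / L ^ (2 * n\<^sub>0)"
          unfolding G by simp
        also have "\<dots> \<le> B / (1 / 2) ^ (2 * n\<^sub>0)"
          using B(1) B(3)[OF hb(2)] L by (intro frac_le power_mono) auto
        finally show "(\<integral>t. ?G t \<partial>lborel) \<le> 2 ^ (2 * n\<^sub>0) * B" by (simp add: power_one_over field_simps)
      qed simp
      finally show "I \<le> sqrt n * (2 ^ (2 * n\<^sub>0) * B)" .
    qed
    have vpos: "0 < v" using v by simp
    have bint: "has_bochner_integral lborel ?d
        (sqrt (2 * pi / v) + 256 * D / n * sqrt (2 * pi / (1 / 4)) + q ^ (n - 2 * n\<^sub>0) * I)"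
      unfolding I_def
      by (intro has_bochner_integral_add has_bochner_integral_mult_right gaussian_integral vpos
          has_bochner_integral_integrable tail) simp
    have int\<psi>: "integrable lborel (\<lambda>s. \<psi> (s / sqrt n) ^ n)"
      by (rule Bochner_Integration.integrable_bound[OF integrable.intros[OF bint]])
         (use dom \<psi>0 in \<open>auto intro: order_trans[OF _ abs_ge_self]\<close>)
    have "(\<integral>s. \<psi> (s / sqrt n) ^ n \<partial>lborel) \<le> sqrt (2 * pi / v) + c1 / n + q ^ (n - 2 * n\<^sub>0) * I"
      using integral_mono[OF int\<psi> integrable.intros[OF bint] dom] has_bochner_integral_integral_eq[OF bint]
      by (simp add: c1_def)
    also have "q ^ (n - 2 * n\<^sub>0) * I \<le> c2 / n"
    proof -
      have "q ^ (n - 2 * n\<^sub>0) = q ^ n / q ^ (2 * n\<^sub>0)" using q n by (simp add: power_diff)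
      then have "q ^ (n - 2 * n\<^sub>0) * I \<le> q ^ n / q ^ (2 * n\<^sub>0) * (sqrt n * (2 ^ (2 * n\<^sub>0) * B))"
        using I q by (simp add: mult_left_mono del: power_mult times_divide_eq_left)
      also have "\<dots> = 2 ^ (2 * n\<^sub>0) * B / q ^ (2 * n\<^sub>0) * (sqrt n * q ^ n)" by simp
      also have "sqrt n * q ^ n \<le> 2 / (ln q)\<^sup>2 / n"
      proof -
        have "sqrt n \<le> sqrt (n * n)" using n1 by (intro real_sqrt_le_mono) (simp flip: of_nat_mult)
        then have "sqrt n \<le> n" by simp
        then have "n * (sqrt n * q ^ n) \<le> n * (n * q ^ n)" using q by (intro mult_left_mono mult_right_mono) auto
        also have "\<dots> = (real n)\<^sup>2 * q ^ n" by (simp add: power2_eq_square)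
        also have "\<dots> \<le> 2 / (ln q)\<^sup>2" by (rule square_times_geometric_bounded[OF q])
        finally show ?thesis using n1 by (subst pos_le_divide_eq) (auto simp: mult.commute)
      qed
      then have "2 ^ (2 * n\<^sub>0) * B / q ^ (2 * n\<^sub>0) * (sqrt n * q ^ n) \<le> 2 ^ (2 * n\<^sub>0) * B / q ^ (2 * n\<^sub>0) * (2 / (ln q)\<^sup>2 / n)"
        using B(1) q by (intro mult_left_mono) auto
      also have "\<dots> = c2 / n" by (simp add: c2_def)
      finally show ?thesis .
    qed
    finally have "(\<integral>s. \<psi> (s / sqrt n) ^ n \<partial>lborel) \<le> sqrt (2 * pi / v) + (c1 + c2) / n"
      by (simp add: add_divide_distrib)
    also have "(c1 + c2) / n = sqrt pi * (C / n)" by (simp add: C_def)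
    also have "\<dots> \<le> sqrt (2 * pi / v) * (C / n)"
    proof (rule mult_right_mono)
      show "sqrt pi \<le> sqrt (2 * pi / v)"
        using v vpos by (intro real_sqrt_le_mono) (simp add: field_simps)
    qed (use c in simp)
    finally have "(\<integral>s. \<psi> (s / sqrt n) ^ n \<partial>lborel) \<le> sqrt (2 * pi / v) * (1 + C / n)" by (simp add: distrib_left)
    moreover have "integrable lborel (\<lambda>s. norm (tilted_char h (s / sqrt n)) ^ n)"
      using integrable_mult_left[OF int\<psi>, of "L ^ n"] L by (simp add: \<psi>_def power_divide)
    ultimately show ?thesis by (simp add: \<psi>_def L_def v_def)
  qed
  show thesis
    using main near(2) r c(3) by (intro that[of r C]) auto
qed

text \<open>
  The tilt \<open>h = x / sqrt n\<close> makes the exponents of the prefactor add up to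
  \<open>x\<^sup>2 / 2 - x\<^sup>2 = - x\<^sup>2 / 2\<close>, that of the normal density, up to the gain \<open>- a * n * h ^ m\<close>.
\<close>

lemma density_le_std_normal_density_times:
  assumes mean: "expectation X = 0" and var: "variance X = 1"
    and n0: "1 \<le> n\<^sub>0" and dens: "has_bounded_density M (normalized_sum Xs n\<^sub>0)"
    and m: "4 \<le> m" "even m"
    and zero: "\<And>k. 3 \<le> k \<Longrightarrow> k < m \<Longrightarrow> cumulant M X k = 0"
    and neg: "cumulant M X m < 0"
  obtains \<tau> C :: real where "0 < \<tau>" "0 \<le> C"
    "\<And>n x. 2 * n\<^sub>0 \<le> n \<Longrightarrow> \<bar>x / sqrt n\<bar> \<le> \<tau> \<Longrightarrow>
      continuous_bounded_density M (normalized_sum Xs n) x \<le> std_normal_density x * (1 + C / n)"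
proof -
  obtain \<rho> a C0 where \<rho>: "0 < \<rho>" "\<rho> < b" "\<rho> \<le> 1" and a: "0 < a" and C0: "0 \<le> C0"
    and K: "\<And>h. \<bar>h\<bar> \<le> \<rho> \<Longrightarrow> cumulant_gen M X h \<le> h\<^sup>2 / 2 - a * h ^ m"
    and K2: "\<And>h. \<bar>h\<bar> \<le> \<rho> \<Longrightarrow> 1 - C0 * h ^ (m - 2) \<le> cgf_deriv 2 h"
    using cgf_expansion[OF mean var m zero neg] by blast
  obtain r C1 where r: "0 < r" "r \<le> b / 4" and C1: "0 \<le> C1"
    and v_ge: "\<And>h. \<bar>h\<bar> \<le> r \<Longrightarrow> 1 / 2 \<le> cgf_deriv 2 h"
    and int: "\<And>h n. \<bar>h\<bar> \<le> r \<Longrightarrow> 2 * n\<^sub>0 \<le> n \<Longrightarrow> integrable lborel (\<lambda>s. norm (tilted_char h (s / sqrt n)) ^ n)"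
    and bnd: "\<And>h n. \<bar>h\<bar> \<le> r \<Longrightarrow> 2 * n\<^sub>0 \<le> n \<Longrightarrow>
      (\<integral>s. (norm (tilted_char h (s / sqrt n)) / exp_moment 0 h) ^ n \<partial>lborel)
        \<le> sqrt (2 * pi / cgf_deriv 2 h) * (1 + C1 / n)"
    using tilted_char_power_integral_le[OF mean var n0 dens] by blast
  define C2 where "C2 = C0\<^sup>2 / a * exp (C0\<^sup>2 / a)"
  have C2: "0 \<le> C2" using a by (simp add: C2_def)
  show thesis
  proof (rule that[of "min \<rho> r" "C1 + C2 + C1 * C2"])
    fix n x
    assume n: "2 * n\<^sub>0 \<le> n" and x: "\<bar>x / sqrt n\<bar> \<le> min \<rho> r"
    define h where "h = x / sqrt n"
    define v where "v = cgf_deriv 2 h"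
    have n1: "1 \<le> n" using n n0 by simp
    then have npos: "0 < real n" by simp
    have h: "\<bar>h\<bar> \<le> \<rho>" "\<bar>h\<bar> \<le> r" "\<bar>h\<bar> \<le> 1" "\<bar>h\<bar> < b" using x \<rho> by (auto simp: h_def)
    have x_h: "x = sqrt n * h" using npos by (simp add: h_def)
    have v: "1 / 2 \<le> v" unfolding v_def by (rule v_ge[OF h(2)])
    have "continuous_bounded_density M (normalized_sum Xs n) x
      \<le> exp_moment 0 h ^ n * exp (- (h * sqrt n * x))
       * ((\<integral>s. (norm (tilted_char h (s / sqrt n)) / exp_moment 0 h) ^ n \<partial>lborel) / (2 * pi))"
      using r h by (intro density_le_tilted_char_integral n1 int n) auto
    also have "\<dots> \<le> exp (x\<^sup>2 / 2 - a * n * h ^ m) * exp (- x\<^sup>2) * (sqrt (2 * pi / v) * (1 + C1 / n) / (2 * pi))"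
    proof (intro mult_mono)
      have "exp_moment 0 h ^ n = exp (n * cumulant_gen M X h)"
        using exp_moment_0_pos[OF h(4)] by (simp add: cumulant_gen_eq exp_of_nat_mult)
      also have "\<dots> \<le> exp (n * (h\<^sup>2 / 2 - a * h ^ m))"
        using K[OF h(1)] npos by simp
      also have "n * (h\<^sup>2 / 2 - a * h ^ m) = x\<^sup>2 / 2 - a * n * h ^ m"
        unfolding x_h using npos by (simp add: power_mult_distrib right_diff_distrib)
      finally show "exp_moment 0 h ^ n \<le> exp (x\<^sup>2 / 2 - a * n * h ^ m)" .
      show "exp (- (h * sqrt n * x)) \<le> exp (- x\<^sup>2)"
        unfolding x_h by (simp add: power2_eq_square mult_ac)
      show "(\<integral>s. (norm (tilted_char h (s / sqrt n)) / exp_moment 0 h) ^ n \<partial>lborel) / (2 * pi)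
          \<le> sqrt (2 * pi / v) * (1 + C1 / n) / (2 * pi)"
        using bnd[OF h(2) n] by (intro divide_right_mono) (auto simp: v_def)
      show "0 \<le> (\<integral>s. (norm (tilted_char h (s / sqrt n)) / exp_moment 0 h) ^ n \<partial>lborel) / (2 * pi)"
        using exp_moment_0_pos[OF h(4)] by (intro divide_nonneg_pos integral_nonneg_AE) auto
    qed auto
    also have "\<dots> = std_normal_density x * (exp (- (a * n * h ^ m)) * (1 / sqrt v) * (1 + C1 / n))"
    proof -
      have "exp (x\<^sup>2 / 2 - a * n * h ^ m) * exp (- x\<^sup>2) = exp (- x\<^sup>2 / 2) * exp (- (a * n * h ^ m))"
        by (simp flip: exp_add)
      moreover have "sqrt (2 * pi / v) / (2 * pi) = 1 / sqrt (2 * pi) * (1 / sqrt v)"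
      proof -
        have "sqrt (2 * pi / v) / (2 * pi) = sqrt (2 * pi) / (sqrt (2 * pi) * sqrt (2 * pi)) / sqrt v"
          by (simp add: real_sqrt_divide)
        also have "\<dots> = 1 / sqrt (2 * pi) * (1 / sqrt v)"
        proof -
          have split: "s / (s * s) / t = 1 / s * (1 / t)" if "s \<noteq> 0" for s t :: real using that by simp
          show ?thesis by (rule split) simp
        qed
        finally show ?thesis .
      qed
      ultimately show ?thesis
        unfolding std_normal_density_def times_divide_eq_left[symmetric]
        by (simp only: mult_ac times_divide_eq_left[symmetric])
    qed
    also have "\<dots> \<le> std_normal_density x * ((1 + C2 / n) * (1 + C1 / n))"
    proof (intro mult_left_mono mult_right_mono)
      have "1 / sqrt v \<le> exp (C0 * h ^ (m - 2))"
        using v K2[OF h(1)] C0 m by (intro inverse_sqrt_le_exp mult_nonneg_nonneg zero_le_even_power) (auto simp: v_def)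
      then have "exp (- (a * n * h ^ m)) * (1 / sqrt v) \<le> exp (- (a * n * h ^ m)) * exp (C0 * h ^ (m - 2))"
        by (rule mult_left_mono) simp
      also have "\<dots> = exp (C0 * h ^ (m - 2) - a * n * h ^ m)" by (simp flip: exp_add)
      also have "\<dots> \<le> 1 + C2 / n"
        unfolding C2_def by (rule exponent_tradeoff[OF a C0 n1 m h(3)])
      finally show "exp (- (a * n * h ^ m)) * (1 / sqrt v) \<le> 1 + C2 / n" .
    qed (use C1 in auto)
    also have "\<dots> \<le> std_normal_density x * (1 + (C1 + C2 + C1 * C2) / n)"
    proof (rule mult_left_mono)
      have "C1 * C2 / n / n \<le> C1 * C2 / n"
        using C1 C2 n1 by (intro divide_left_mono[where b=1, simplified]) auto
      then show "(1 + C2 / n) * (1 + C1 / n) \<le> 1 + (C1 + C2 + C1 * C2) / n"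
        by (simp add: algebra_simps add_divide_distrib)
    qed simp
    finally show "continuous_bounded_density M (normalized_sum Xs n) x
        \<le> std_normal_density x * (1 + (C1 + C2 + C1 * C2) / n)" .
  qed (use \<rho> r C1 C2 in auto)
qed

end

theorem corollary1p3:
  fixes M :: "'a measure" and X :: "'a \<Rightarrow> real" and Xs :: "nat \<Rightarrow> 'a \<Rightarrow> real"
    and n\<^sub>0 m :: nat and b :: real
  assumes "prob_space M"
    and "X \<in> borel_measurable M"
    and "\<not> normally_distributed M X"
    and "prob_space.expectation M X = 0"
    and "prob_space.variance M X = 1"
    and "0 < b" and "integrable M (\<lambda>\<omega>. exp (b * \<bar>X \<omega>\<bar>))"
    and "independent_copies M X Xs"
    and "1 \<le> n\<^sub>0" and "has_bounded_density M (normalized_sum Xs n\<^sub>0)"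
    and "m = (LEAST k. 3 \<le> k \<and> cumulant M X k \<noteq> 0)"
    and "even m" and "4 \<le> m" and "cumulant M X m < 0"
  shows "\<exists>\<tau>\<^sub>0>0. \<exists>c>0. \<forall>n\<ge>2 * n\<^sub>0. \<forall>x :: real. \<bar>x / sqrt (real n)\<bar> \<le> \<tau>\<^sub>0 \<longrightarrow>
    (continuous_bounded_density M (normalized_sum Xs n) x - std_normal_density x)
        / std_normal_density x
      \<le> c * (ln (real n)) ^ 3 / real n"
proof -
  interpret iid_exponential_moments M X b Xs
    using assms(1,2,6,7,8)
    by (auto simp: iid_exponential_moments_def iid_exponential_moments_axioms_def
        exponential_moments_def exponential_moments_axioms_def independent_copies_def)
  have zero: "cumulant M X k = 0" if "3 \<le> k" "k < m" for k
    using not_less_Least[of k "\<lambda>k. 3 \<le> k \<and> cumulant M X k \<noteq> 0"] that assms(11) by auto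
  obtain \<tau> C :: real where \<tau>: "0 < \<tau>" and C: "0 \<le> C"
    and bound: "\<And>n x. 2 * n\<^sub>0 \<le> n \<Longrightarrow> \<bar>x / sqrt n\<bar> \<le> \<tau> \<Longrightarrow>
      continuous_bounded_density M (normalized_sum Xs n) x \<le> std_normal_density x * (1 + C / n)"
    using density_le_std_normal_density_times[OF assms(4,5,9,10,13,12) zero assms(14)] by blast
  define c where "c = (C + 1) / (ln 2) ^ 3"
  have c: "0 < c" using C by (simp add: c_def)
  have "(continuous_bounded_density M (normalized_sum Xs n) x - std_normal_density x) / std_normal_density x
      \<le> c * (ln (real n)) ^ 3 / real n"
    if n: "2 * n\<^sub>0 \<le> n" and x: "\<bar>x / sqrt (real n)\<bar> \<le> \<tau>" for n x
  proof -
    have pos: "0 < std_normal_density x" by (simp add: normal_density_pos)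
    have n2: "2 \<le> real n" using n assms(9) by linarith
    have "continuous_bounded_density M (normalized_sum Xs n) x - std_normal_density x
        \<le> C / n * std_normal_density x"
      using bound[OF n x] by (simp add: algebra_simps)
    then have "(continuous_bounded_density M (normalized_sum Xs n) x - std_normal_density x) / std_normal_density x \<le> C / n"
      using pos by (simp add: pos_divide_le_eq)
    also have "\<dots> \<le> c * (ln (real n)) ^ 3 / real n"
    proof (rule divide_right_mono)
      have "C \<le> c * (ln 2) ^ 3" using C by (simp add: c_def)
      also have "\<dots> \<le> c * (ln (real n)) ^ 3"
        using c n2 by (intro mult_left_mono power_mono) auto
      finally show "C \<le> c * (ln (real n)) ^ 3" .
    qed simp
    finally show ?thesis .
  qed
  with \<tau> c show ?thesis by blast
qed

end
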